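(* Let $n\ge 1$ be an integer. The zeta regularized determinant of the Laplacian, as a function on the space of $n$-dimensional orthogonal flat tori $\mathbb{R}^n/\Gamma$ (with $\Gamma$ an orthogonal lattice) with volume $1$, attains a maximum.
   Context: An orthogonal lattice is a subset $\Gamma$ of $\mathbb{R}^n$ of the form $D\mathbb{Z}^n$ with $D$ a diagonal invertible real $n\times n$ matrix. An $n$-dimensional orthogonal torus is the flat Riemannian manifold $\mathbb{R}^n/D\mathbb{Z}^n$; its volume is $|\det D|$. For $D=\operatorname{diag}(q_1,\dots,q_n)$, the eigenvalues of the (nonnegative) Laplacian on $\mathbb{R}^n/D\mathbb{Z}^n$, counted with multiplicity, are $\lambda_k = 4\pi^2\sum_{j=1}^n k_j^2/q_j^2$, $k\in\mathbb{Z}^n$. The spectral zeta function is $\zeta_\circ(s)=\sum_{k\in\mathbb{Z}^n\setminus\{0\}}\lambda_k^{-s}$ for $\operatorname{Re}(s)>n/2$. It extends meromorphically to $\mathbb{C}$ and is holomorphic near $s=0$. The zeta regularized determinant of the Laplacian is $e^{-\zeta_\circ'(0)}$, where $\zeta_\circ'(0)$ is computed from this continuation. *)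

theory Defs
  imports "HOL-Complex_Analysis.Complex_Analysis"
begin

no_notation fps_nth (infixl \<open>$\<close> 75)

definition diagonal_invertible :: "real^'n^'n \<Rightarrow> bool" where
  "diagonal_invertible D \<longleftrightarrow> (\<forall>i j. i \<noteq> j \<longrightarrow> D $ i $ j = 0) \<and> invertible D"

definition integer_lattice :: "(real^'n) set" where
  "integer_lattice = {x. \<forall>i. x $ i \<in> \<int>}"

definition orthogonal_lattice :: "(real^'n) set \<Rightarrow> bool" where
  "orthogonal_lattice \<Gamma> \<longleftrightarrow> (\<exists>D. diagonal_invertible D \<and> \<Gamma> = (\<lambda>x. D *v x) ` integer_lattice)"

text \<open>
  The torus \<open>\<real>\<^sup>n/\<Gamma>\<close> is represented by the lattice \<open>\<Gamma>\<close>. The matrix \<open>D\<close> with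
  \<open>\<Gamma> = D\<int>\<^sup>n\<close> is unique only up to the signs of its diagonal entries; all quantities below
  depend on these entries through their absolute values alone, so the choice made here is
  immaterial (see \<open>torus_volume_eq\<close> and \<open>laplace_eigenvalue_eq\<close>).
\<close>

definition lattice_matrix :: "(real^'n) set \<Rightarrow> real^'n^'n" where
  "lattice_matrix \<Gamma> = (SOME D. diagonal_invertible D \<and> \<Gamma> = (\<lambda>x. D *v x) ` integer_lattice)"

definition torus_volume :: "(real^'n) set \<Rightarrow> real" where
  "torus_volume \<Gamma> = \<bar>det (lattice_matrix \<Gamma>)\<bar>"

text \<open>Eigenvalues of the nonnegative Laplacian, listed with multiplicity by \<open>k \<in> \<int>\<^sup>n\<close>.\<close>

definition laplace_eigenvalue :: "(real^'n) set \<Rightarrow> int^'n \<Rightarrow> real" where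
  "laplace_eigenvalue \<Gamma> k =
     4 * pi^2 * (\<Sum>j\<in>UNIV. (of_int (k $ j))^2 / (lattice_matrix \<Gamma> $ j $ j)^2)"

definition spectral_zeta_series :: "(real^'n) set \<Rightarrow> complex \<Rightarrow> complex" where
  "spectral_zeta_series \<Gamma> s =
     (\<Sum>\<^sub>\<infinity>k\<in>UNIV - {0}. complex_of_real (laplace_eigenvalue \<Gamma> k) powr (- s))"

definition is_spectral_zeta :: "(real^'n) set \<Rightarrow> (complex \<Rightarrow> complex) \<Rightarrow> bool" where
  "is_spectral_zeta \<Gamma> Z \<longleftrightarrow>
     Z meromorphic_on UNIV \<and> Z analytic_on {0} \<and>
     (\<forall>s. Re s > real CARD('n) / 2 \<longrightarrow> Z s = spectral_zeta_series \<Gamma> s)"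

text \<open>
  Continuations may differ in their values on a discrete set (meromorphic functions are total
  here), but not near 0; see \<open>is_spectral_zeta_unique\<close>.
\<close>

definition spectral_zeta :: "(real^'n) set \<Rightarrow> complex \<Rightarrow> complex" where
  "spectral_zeta \<Gamma> = (SOME Z. is_spectral_zeta \<Gamma> Z)"

text \<open>
  The zeta function is real on the real axis, so its derivative at 0 is real and \<open>Re\<close> merely
  converts the type.
\<close>

definition laplace_zeta_det :: "(real^'n) set \<Rightarrow> real" where
  "laplace_zeta_det \<Gamma> = Re (exp (- deriv (spectral_zeta \<Gamma>) 0))"


lemma diagonal_mult_vec:
  assumes "diagonal_invertible (D :: real^'n^'n)"
  shows "(D *v x) $ i = D $ i $ i * x $ i"
proof -
  have "(D *v x) $ i = (\<Sum>j\<in>UNIV. D $ i $ j * x $ j)"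
    by (simp add: matrix_vector_mult_def)
  also have "\<dots> = (\<Sum>j\<in>{i}. D $ i $ j * x $ j)"
    using assms by (intro sum.mono_neutral_right) (auto simp: diagonal_invertible_def)
  finally show ?thesis by simp
qed

lemma diagonal_det:
  assumes "diagonal_invertible (D :: real^'n^'n)"
  shows "det D = (\<Prod>i\<in>UNIV. D $ i $ i)"
  using assms by (intro det_diagonal) (auto simp: diagonal_invertible_def)

lemma diagonal_entry_nonzero:
  assumes "diagonal_invertible (D :: real^'n^'n)"
  shows "D $ i $ i \<noteq> 0"
  using assms diagonal_det[OF assms]
  by (auto simp: diagonal_invertible_def invertible_det_nz)

lemma diagonal_entry_le:
  assumes D: "diagonal_invertible (D :: real^'n^'n)" and E: "diagonal_invertible E"
    and sub: "(\<lambda>x. E *v x) ` integer_lattice \<subseteq> (\<lambda>x. D *v x) ` integer_lattice"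
  shows "\<bar>D $ i $ i\<bar> \<le> \<bar>E $ i $ i\<bar>"
proof -
  have "axis i 1 \<in> (integer_lattice :: (real^'n) set)"
    by (auto simp: integer_lattice_def axis_def)
  then obtain x where x: "x \<in> integer_lattice" "E *v axis i 1 = D *v x"
    using sub by blast
  have "(E *v axis i 1) $ i = (D *v x) $ i" using x by simp
  then have eq: "E $ i $ i = D $ i $ i * x $ i"
    by (simp add: diagonal_mult_vec[OF D] diagonal_mult_vec[OF E])
  obtain m :: int where m: "x $ i = of_int m"
    using x(1) by (auto simp: integer_lattice_def elim: Ints_cases)
  have "m \<noteq> 0" using eq m diagonal_entry_nonzero[OF E, of i] by auto
  then have "1 \<le> \<bar>real_of_int m\<bar>" by linarith
  then show ?thesis
    using eq m mult_left_mono[of 1 "\<bar>real_of_int m\<bar>" "\<bar>D $ i $ i\<bar>"] by (simp add: abs_mult)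
qed

lemma lattice_matrix_entry_abs:
  assumes "diagonal_invertible (D :: real^'n^'n)" "\<Gamma> = (\<lambda>x. D *v x) ` integer_lattice"
  shows "diagonal_invertible (lattice_matrix \<Gamma>)"
    and "\<bar>lattice_matrix \<Gamma> $ i $ i\<bar> = \<bar>D $ i $ i\<bar>"
proof -
  have *: "diagonal_invertible (lattice_matrix \<Gamma>) \<and>
        \<Gamma> = (\<lambda>x. lattice_matrix \<Gamma> *v x) ` integer_lattice"
    unfolding lattice_matrix_def by (rule someI[of _ D]) (use assms in auto)
  then show "diagonal_invertible (lattice_matrix \<Gamma>)" by blast
  show "\<bar>lattice_matrix \<Gamma> $ i $ i\<bar> = \<bar>D $ i $ i\<bar>"
    using * assms by (intro antisym diagonal_entry_le) auto
qed

lemma torus_volume_eq: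
  assumes "diagonal_invertible (D :: real^'n^'n)" "\<Gamma> = (\<lambda>x. D *v x) ` integer_lattice"
  shows "torus_volume \<Gamma> = \<bar>det D\<bar>"
  unfolding torus_volume_def diagonal_det[OF lattice_matrix_entry_abs(1)[OF assms]]
    diagonal_det[OF assms(1)] abs_prod lattice_matrix_entry_abs(2)[OF assms] ..

lemma laplace_eigenvalue_eq:
  assumes "diagonal_invertible (D :: real^'n^'n)" "\<Gamma> = (\<lambda>x. D *v x) ` integer_lattice"
  shows "laplace_eigenvalue \<Gamma> k = 4 * pi^2 * (\<Sum>j\<in>UNIV. (of_int (k $ j))^2 / (D $ j $ j)^2)"
proof -
  have "(lattice_matrix \<Gamma> $ j $ j)^2 = (D $ j $ j)^2" for j
    using lattice_matrix_entry_abs(2)[OF assms, of j] by (metis power2_abs)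
  then show ?thesis by (simp add: laplace_eigenvalue_def)
qed

lemma is_spectral_zeta_unique:
  assumes "is_spectral_zeta (\<Gamma> :: (real^'n) set) Z" "is_spectral_zeta \<Gamma> W"
  shows "eventually (\<lambda>s. Z s = W s) (nhds 0)" and "deriv Z 0 = deriv W 0"
proof -
  define d where "d = (\<lambda>s. Z s - W s)"
  have mero: "d meromorphic_on UNIV" and ana: "d analytic_on {0}"
    using assms unfolding d_def is_spectral_zeta_def
    by (auto intro!: meromorphic_intros analytic_intros)
  define c :: complex where "c = of_real (real CARD('n) / 2 + 1)"
  have "open {s. Re s > real CARD('n) / 2}" by (rule open_halfspace_Re_gt)
  moreover have "c \<in> {s. Re s > real CARD('n) / 2}" by (simp add: c_def)
  ultimately have "eventually (\<lambda>s. s \<in> {s. Re s > real CARD('n) / 2}) (at c)"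
    using eventually_at_topological by blast
  then have dc: "eventually (\<lambda>s. d s = 0) (at c)"
    by eventually_elim (use assms in \<open>auto simp: d_def is_spectral_zeta_def\<close>)
  have rs: "eventually (\<lambda>s. remove_sings d s = d s) (at z)" for z
    using mero by (intro eventually_remove_sings_eq_at)
      (auto intro: meromorphic_on_isolated_singularity meromorphic_on_subset)
  have "eventually (\<lambda>s. remove_sings d s = 0) (at c)"
    using dc rs[of c] by eventually_elim simp
  then have "frequently (\<lambda>s. remove_sings d s = 0) (at c)"
    by (intro eventually_frequently) auto
  then have "remove_sings d w = 0" for w
    by (rule frequently_eq_meromorphic_imp_constant[where A = UNIV])
      (use mero in \<open>auto intro: remove_sings_nicely_meromorphic\<close>)
  then have d0: "eventually (\<lambda>s. d s = 0) (at 0)"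
    using rs[of 0] by simp
  moreover have "d 0 = 0"
  proof -
    have "d \<midarrow>0\<rightarrow> d 0"
      using ana analytic_at_imp_isCont isCont_def by blast
    moreover have "d \<midarrow>0\<rightarrow> 0"
      using d0 tendsto_eventually by blast
    ultimately show ?thesis by (metis LIM_unique)
  qed
  ultimately have "eventually (\<lambda>s. d s = 0) (nhds 0)"
    using d0 by (simp add: eventually_nhds_conv_at)
  then show *: "eventually (\<lambda>s. Z s = W s) (nhds 0)" by (simp add: d_def)
  show "deriv Z 0 = deriv W 0" by (rule deriv_cong_ev[OF * refl])
qed

end

theory Submission
  imports Defs "HOL-Probability.Probability"
begin

no_notation fps_nth (infixl \<open>$\<close> 75)

text \<open>
  Put \<open>a\<^sub>j = 1 / q\<^sub>j\<^sup>2\<close>, \<open>Q\<^sub>a(k) = \<Sum> a\<^sub>j k\<^sub>j\<^sup>2\<close> and \<open>\<Theta>\<^sub>a(t) = \<Sum>\<^sub>k exp (-\<pi> Q\<^sub>a(k) t)\<close>, a product of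
  one-dimensional theta functions. For volume 1 Jacobi's inversion formula reads
  \<open>\<Theta>\<^sub>a(t) = t powr (-n/2) * \<Theta>\<^sub>1\<^sub>/\<^sub>a(1/t)\<close>. Riemann's argument then continues the zeta function: up to the factor
  \<open>(4\<pi>) powr -s\<close> it is \<open>(M\<^sub>a(s) + 1/(s - n/2) - 1/s) / \<Gamma>(s)\<close>, where \<open>M\<^sub>a\<close> is the (entire) Mellin transform
  of \<open>\<Theta>\<^sub>a(t) - 1\<close> on \<open>t > 1\<close> and of \<open>t powr (-n/2) * (\<Theta>\<^sub>1\<^sub>/\<^sub>a(1/t) - 1)\<close> on \<open>t \<le> 1\<close>. Hence
  the determinant is a positive constant times \<open>exp (-M\<^sub>a(0))\<close>. The function \<open>a \<mapsto> M\<^sub>a(0)\<close> is continuous by dominated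
  convergence, and \<open>M\<^sub>a(0) \<ge> exp (-\<pi>) * ln (1/a\<^sub>j)\<close> makes it proper on \<open>\<Prod> a\<^sub>j = 1\<close>, so it attains a
  minimum.
\<close>

section \<open>Mellin transforms and Dirichlet series\<close>

text \<open>Expand \<open>t powr (s - 1)\<close> in powers of \<open>s * ln t\<close> and integrate termwise.\<close>

lemma mellin_entire:
  fixes w :: "real \<Rightarrow> real"
  assumes [measurable]: "w \<in> borel_measurable borel"
    and int: "\<And>\<sigma>. integrable lborel (\<lambda>t. indicator {0<..} t * (t powr \<sigma> * w t))"
  shows "(\<lambda>s. LINT t|lborel. indicator {0<..} t *\<^sub>R (complex_of_real t powr (s - 1) * of_real (w t)))
           holomorphic_on UNIV"
proof -
  \<comment> \<open>The \<open>n\<close>-th term of the expansion. Since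
    \<open>h s n = s ^ n * h 1 n\<close>, termwise integration produces a power series in
    \<open>s\<close> whose coefficients are the integrals of \<open>h 1 n\<close>.\<close>
  define h :: "complex \<Rightarrow> nat \<Rightarrow> real \<Rightarrow> complex" where
    "h = (\<lambda>s n t. indicator {0<..} t *\<^sub>R
            ((s * of_real (ln t)) ^ n /\<^sub>R fact n * of_real (t powr - 1 * w t)))"
  have [measurable]: "h s n \<in> borel_measurable borel" for s n
    unfolding h_def by measurable
  have sums: "(\<lambda>n. (LINT t|lborel. h 1 n t) * (s - 0) ^ n) sums
      (LINT t|lborel. indicator {0<..} t *\<^sub>R (complex_of_real t powr (s - 1) * of_real (w t)))" for s
  proof -
    \<comment> \<open>Dominates every partial sum of norms:
      \<open>exp (norm s * \<bar>ln t\<bar>)\<close> is at most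
      \<open>t powr norm s + t powr - norm s\<close>, one summand serving \<open>t \<ge> 1\<close>
      and the other \<open>t < 1\<close>.\<close>
    define W where "W = (\<lambda>t. indicator {0<..} t * (t powr (norm s - 1) * \<bar>w t\<bar>)
                           + indicator {0<..} t * (t powr (- norm s - 1) * \<bar>w t\<bar>))"
    have aux: "(\<lambda>t. indicator {0<..} t * (t powr \<sigma> * \<bar>w t\<bar>)) =
        (\<lambda>t. norm (indicator {0<..} t * (t powr \<sigma> * w t)))" for \<sigma>
      by (auto simp: abs_mult)
    have W: "integrable lborel W"
      unfolding W_def by (intro Bochner_Integration.integrable_add; unfold aux; intro integrable_norm int)
    have nh: "norm (h s n t) = indicator {0<..} t * ((norm s * \<bar>ln t\<bar>) ^ n /\<^sub>R fact n * (t powr -1 * \<bar>w t\<bar>))" for n t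
      by (auto simp: h_def norm_mult norm_power abs_mult norm_divide split: split_indicator)
    have nsums: "(\<lambda>n. norm (h s n t)) sums (indicator {0<..} t * (exp (norm s * \<bar>ln t\<bar>) * (t powr -1 * \<bar>w t\<bar>)))" for t
      unfolding nh by (intro sums_mult sums_mult2 exp_converges)
    have le: "indicator {0<..} t * (exp (norm s * \<bar>ln t\<bar>) * (t powr -1 * \<bar>w t\<bar>)) \<le> W t" for t
    proof (cases "t > 0")
      case True
      have "exp (norm s * \<bar>ln t\<bar>) \<le> exp (norm s * ln t) + exp (- norm s * ln t)"
        by (cases "ln t \<ge> 0") (auto intro: order_trans)
      then have "exp (norm s * \<bar>ln t\<bar>) \<le> t powr norm s + t powr - norm s"
        using True by (simp add: powr_def)
      then have "exp (norm s * \<bar>ln t\<bar>) * (t powr -1 * \<bar>w t\<bar>)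
          \<le> (t powr norm s + t powr - norm s) * (t powr -1 * \<bar>w t\<bar>)"
        by (intro mult_right_mono) auto
      also have "\<dots> = W t" using True
        by (simp add: W_def powr_diff powr_minus divide_simps ring_distribs)
      finally show ?thesis using True by simp
    qed (simp add: W_def)
    have nle: "norm (\<Sum>i<n. norm (h s i t)) \<le> norm (W t)" for n t
    proof -
      have "(\<Sum>i<n. norm (h s i t)) \<le> (\<Sum>i. norm (h s i t))"
        by (intro sum_le_suminf sums_summable[OF nsums]) auto
      also have "\<dots> = indicator {0<..} t * (exp (norm s * \<bar>ln t\<bar>) * (t powr -1 * \<bar>w t\<bar>))"
        by (rule sums_unique[OF nsums, symmetric])
      also note le
      finally have "(\<Sum>i<n. norm (h s i t)) \<le> W t" .
      moreover have "0 \<le> (\<Sum>i<n. norm (h s i t))" by (intro sum_nonneg) auto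
      ultimately show ?thesis by simp
    qed
    have inth: "integrable lborel (h s n)" for n
    proof (rule Bochner_Integration.integrable_bound[OF W])
      have "norm (h s n t) \<le> norm (W t)" for t
        using nle[of t "Suc n"] sum_nonneg[of "{..<n}" "\<lambda>i. norm (h s i t)"]  by simp
      then show "AE t in lborel. norm (h s n t) \<le> norm (W t)" by simp
    qed simp
    have "summable (\<lambda>n. LINT t|lborel. norm (h s n t))"
    proof (rule bounded_imp_summable)
      fix n
      have "(\<Sum>i\<le>n. LINT t|lborel. norm (h s i t)) = (LINT t|lborel. (\<Sum>i\<le>n. norm (h s i t)))"
        by (intro Bochner_Integration.integral_sum[symmetric] integrable_norm inth)
      also have "\<dots> \<le> (LINT t|lborel. norm (W t))"
        using nle[of _ "Suc n"]
        by (intro integral_mono integrable_norm W Bochner_Integration.integrable_sum inth)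
           (auto simp: lessThan_Suc_atMost abs_le_iff)
      finally show "(\<Sum>i\<le>n. LINT t|lborel. norm (h s i t)) \<le> (LINT t|lborel. norm (W t))" .
    qed auto
    then have "(\<lambda>n. LINT t|lborel. h s n t) sums (LINT t|lborel. (\<Sum>n. h s n t))"
      by (intro sums_integral inth) (use nsums in \<open>auto simp: sums_iff\<close>)
    moreover have "(\<Sum>n. h s n t) = indicator {0<..} t *\<^sub>R (complex_of_real t powr (s - 1) * of_real (w t))" for t
    proof (cases "t > 0")
      case True
      have "(\<lambda>n. h s n t) sums (indicator {0<..} t *\<^sub>R
            (exp (s * of_real (ln t)) * of_real (t powr - 1 * w t)))"
        unfolding h_def by (intro sums_scaleR_right sums_mult2 exp_converges)
      moreover have "exp (s * of_real (ln t)) * of_real (t powr - 1 * w t) = complex_of_real t powr (s - 1) * of_real (w t)"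
      proof -
        have "exp (complex_of_real (ln t)) = of_real t"
          using True by (simp add: exp_of_real)
        then show ?thesis using True
          by (simp add: powr_def exp_diff left_diff_distrib Ln_of_real exp_minus powr_minus divide_simps)
      qed
      ultimately show ?thesis by (simp add: sums_iff)
    qed (simp add: h_def)
    moreover have "(LINT t|lborel. h s n t) = (LINT t|lborel. h 1 n t) * s ^ n" for n
      unfolding h_def by (subst Bochner_Integration.integral_mult_left_zero[symmetric])
        (auto intro!: Bochner_Integration.integral_cong simp: power_mult_distrib)
    ultimately show ?thesis by simp
  qed
  have "(\<lambda>s. LINT t|lborel. indicator {0<..} t *\<^sub>R (complex_of_real t powr (s - 1) * of_real (w t)))
           holomorphic_on ball 0 r" for r
    by (rule power_series_holomorphic[OF sums])
  then have "(\<lambda>s. LINT t|lborel. indicator {0<..} t *\<^sub>R (complex_of_real t powr (s - 1) * of_real (w t)))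
           field_differentiable at z" for z
    by (rule holomorphic_on_imp_differentiable_at[of _ "ball 0 (norm z + 1)"]) simp_all
  then show ?thesis
    unfolding holomorphic_on_def by (blast intro: field_differentiable_at_within)
qed

text \<open>A single term of the exponential series suffices: \<open>exp (m * x)\<close> is at least
  \<open>(m * x) ^ N / fact N\<close>, and an integer \<open>N \<ge> q\<close> absorbs the power
  because \<open>x \<ge> 1\<close>.\<close>

lemma powr_times_exp_bounded:
  fixes m q :: real
  assumes "m > 0"
  shows "\<exists>C. \<forall>x\<ge>1. x powr q * exp (- m * x) \<le> C"
proof -
  define N where "N = nat \<lceil>\<bar>q\<bar>\<rceil>"
  have "x powr q * exp (- m * x) \<le> fact N / m ^ N" if "x \<ge> 1" for x
  proof -
    have "q \<le> real N" unfolding N_def by linarith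
    then have "x powr q \<le> x powr real N"
      using that by (intro powr_mono) auto
    then have le: "x powr q \<le> x ^ N"
      using that by (simp add: powr_realpow)
    have "(m * x) ^ N /\<^sub>R fact N \<le> (\<Sum>n. (m * x) ^ n /\<^sub>R fact n)"
      using sum_le_suminf[OF sums_summable[OF exp_converges[of "m * x"]], of "{N}"] assms that
      by simp
    then have "(m * x) ^ N / fact N \<le> exp (m * x)"
      by (simp add: exp_def divide_inverse mult.commute)
    then have "x ^ N * exp (- m * x) \<le> fact N / m ^ N"
      using assms by (simp add: exp_minus field_simps power_mult_distrib)
    then show ?thesis
      using order_trans[OF mult_right_mono[OF le, of "exp (- m * x)"]] by simp
  qed
  then show ?thesis by blast
qed

text \<open>The bounds for the two exponents \<sigma> and \<sigma> + 2 add up to a bound by a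
  multiple of \<open>inverse (1 + t\<^sup>2)\<close>, which is integrable on the whole line.\<close>

lemma integrable_rapid_decay:
  fixes w :: "real \<Rightarrow> real"
  assumes [measurable]: "w \<in> borel_measurable borel"
    and decay: "\<And>q. \<exists>C. \<forall>t>0. \<bar>t powr q * w t\<bar> \<le> C"
  shows "integrable lborel (\<lambda>t. indicator {0<..} t * (t powr \<sigma> * w t))"
proof -
  obtain C1 where C1: "\<And>t. t > 0 \<Longrightarrow> \<bar>t powr \<sigma> * w t\<bar> \<le> C1" using decay by blast
  obtain C2 where C2: "\<And>t. t > 0 \<Longrightarrow> \<bar>t powr (\<sigma> + 2) * w t\<bar> \<le> C2" using decay by blast
  have "integrable lborel (\<lambda>t::real. inverse (1 + t\<^sup>2))"
    using integrable_inverse_1_plus_square by (simp add: set_integrable_def)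
  then have "integrable lborel (\<lambda>t::real. (C1 + C2) * inverse (1 + t\<^sup>2))"
    by simp
  then show ?thesis
  proof (rule Bochner_Integration.integrable_bound)
    have "norm (indicator {0<..} t * (t powr \<sigma> * w t)) \<le> norm ((C1 + C2) * inverse (1 + t\<^sup>2))" for t :: real
    proof (cases "t > 0")
      case True
      have "t powr (\<sigma> + 2) = t powr \<sigma> * t\<^sup>2"
        using True by (simp add: powr_add)
      then have "\<bar>t powr \<sigma> * w t\<bar> * (1 + t\<^sup>2) \<le> C1 + C2"
        using C1[OF True] C2[OF True] by (simp add: abs_mult algebra_simps)
      then have "\<bar>t powr \<sigma> * w t\<bar> \<le> (C1 + C2) / (1 + t\<^sup>2)"
        by (simp add: pos_le_divide_eq add_pos_nonneg)
      also have "\<dots> \<le> \<bar>(C1 + C2) / (1 + t\<^sup>2)\<bar>" by (rule abs_ge_self)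
      finally show ?thesis
        using True by (simp add: divide_inverse)
    qed simp
    then show "AE t in lborel. norm (indicator {0<..} t * (t powr \<sigma> * w t)) \<le> norm ((C1 + C2) * inverse (1 + t\<^sup>2))"
      by simp
  qed simp
qed

text \<open>Euler's integral after the substitution of \<open>\<mu> * t\<close> for
  \<open>t\<close>. It turns each exponential of a theta series into a term of a Dirichlet
  series.\<close>

lemma has_bochner_integral_Gamma:
  fixes \<mu> :: real
  assumes "\<mu> > 0" "Re s > 0"
  shows "has_bochner_integral lborel
    (\<lambda>t. indicator {0<..} t *\<^sub>R (complex_of_real t powr (s - 1) * of_real (exp (- \<mu> * t))))
    (Gamma s * of_real \<mu> powr - s)"
proof -
  define f where "f = (\<lambda>t. indicator {0<..} t *\<^sub>R (complex_of_real t powr (s - 1) / of_real (exp t)))"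
  have [measurable]: "f \<in> borel_measurable borel" unfolding f_def by measurable
  have int: "integrable lborel f"
    using absolutely_integrable_Gamma_integral'[OF assms(2)]
    by (simp add: f_def set_integrable_def integrable_completion)
  have "(f has_integral Gamma s) UNIV"
  proof -
    have "(\<lambda>t. if t \<in> {0<..} then complex_of_real t powr (s - 1) / of_real (exp t) else 0) = f"
      by (auto simp: f_def fun_eq_iff)
    then show ?thesis
      using Gamma_integral_complex'[OF assms(2)]
      by (subst (asm) has_integral_restrict_UNIV[symmetric]) simp
  qed
  then have "has_bochner_integral lborel f (Gamma s)"
    using has_integral_integral_lborel[OF int] int has_integral_unique
    by (auto simp: has_bochner_integral_iff)
  then have "has_bochner_integral lborel (\<lambda>t. f (0 + \<mu> * t)) (Gamma s /\<^sub>R \<bar>\<mu>\<bar>)"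
    using assms by (subst (asm) lborel_has_bochner_integral_real_affine_iff[of \<mu> _ _ 0]) auto
  \<comment> \<open>The factor cancels the power of \<mu> inside
    \<open>(\<mu> * t) powr (s - 1)\<close>; together with the Jacobian \<open>1 / \<mu>\<close> it
    leaves \<open>\<mu> powr - s\<close>.\<close>
  then have "has_bochner_integral lborel (\<lambda>t. of_real \<mu> powr (1 - s) * f (0 + \<mu> * t))
      (of_real \<mu> powr (1 - s) * (Gamma s /\<^sub>R \<bar>\<mu>\<bar>))"
    by (rule has_bochner_integral_mult_right)
  also have "(\<lambda>t. of_real \<mu> powr (1 - s) * f (0 + \<mu> * t)) =
     (\<lambda>t. indicator {0<..} t *\<^sub>R (complex_of_real t powr (s - 1) * of_real (exp (- \<mu> * t))))"
  proof
    fix t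
    show "of_real \<mu> powr (1 - s) * f (0 + \<mu> * t) =
       indicator {0<..} t *\<^sub>R (complex_of_real t powr (s - 1) * of_real (exp (- \<mu> * t)))"
    proof (cases "t > 0")
      case True
      have "of_real \<mu> powr (1 - s) * of_real (\<mu> * t) powr (s - 1) =
         (of_real \<mu> powr (1 - s) * of_real \<mu> powr (s - 1)) * complex_of_real t powr (s - 1)"
        using assms True by (simp add: powr_times_real)
      also have "of_real \<mu> powr (1 - s) * complex_of_real \<mu> powr (s - 1) = 1"
        using assms by (simp flip: powr_add)
      finally show ?thesis
        using assms True by (simp add: f_def exp_minus divide_inverse)
    qed (use assms in \<open>simp add: f_def zero_less_mult_iff\<close>)
  qed
  also have "of_real \<mu> powr (1 - s) * (Gamma s /\<^sub>R \<bar>\<mu>\<bar>) = Gamma s * complex_of_real \<mu> powr - s"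
    using assms by (simp add: powr_diff powr_minus scaleR_conv_of_real divide_simps)
  finally show ?thesis .
qed

text \<open>Source of the polar terms \<open>1 / (s - p)\<close> and \<open>1 / s\<close>: they are
  the Mellin transforms on the unit interval of \<open>t powr - p\<close> and of 1.\<close>

lemma has_bochner_integral_powr_unit:
  assumes "Re z > 0"
  shows "has_bochner_integral lborel
    (\<lambda>t. indicator {0<..1} t *\<^sub>R (complex_of_real t powr (z - 1))) (1 / z)"
proof -
  define f where "f = (\<lambda>t. indicator {0<..1} t *\<^sub>R (complex_of_real t powr (z - 1)))"
  have [measurable]: "f \<in> borel_measurable borel" unfolding f_def by measurable
  have "(\<lambda>t. t powr (Re z - 1)) absolutely_integrable_on {0<..1}"
    using assms by (intro nonnegative_absolutely_integrable_1 integrable_on_powr_from_0') auto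
  then have "integrable lborel (\<lambda>t. indicator {0<..1} t *\<^sub>R (t powr (Re z - 1)))"
    unfolding set_integrable_def by (subst (asm) integrable_completion) auto
  then have int: "integrable lborel f"
    by (rule Bochner_Integration.integrable_bound)
       (auto simp: f_def norm_powr_real_powr split: split_indicator)
  \<comment> \<open>The integrand may blow up at 0, so the version of the fundamental theorem is
    used that asks for a derivative only in the interior; \<open>t powr z\<close> is still
    continuous at 0 because \<open>Re z > 0\<close>.\<close>
  have "((\<lambda>t. complex_of_real t powr (z - 1)) has_integral (of_real 1 powr z / z - of_real 0 powr z / z)) {0..1}"
  proof (rule fundamental_theorem_of_calculus_interior)
    show "continuous_on {0..1} (\<lambda>t. complex_of_real t powr z / z)"
      using assms by (auto intro!: continuous_intros continuous_on_powr_complex)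
    show "((\<lambda>t. complex_of_real t powr z / z) has_vector_derivative of_real t powr (z - 1)) (at t)"
      if "t \<in> {0<..<1}" for t
      using that assms by (auto intro!: derivative_eq_intros has_vector_derivative_real_field)
  qed simp
  moreover have "(\<lambda>t. if t \<in> {0..1} then complex_of_real t powr (z - 1) else 0) = f"
    by (auto simp: f_def fun_eq_iff split: split_indicator)
  ultimately have "(f has_integral 1 / z) UNIV"
    using assms by (subst (asm) has_integral_restrict_UNIV[symmetric]) simp
  then show ?thesis
    using has_integral_integral_lborel[OF int] int has_integral_unique
    unfolding f_def[symmetric] by (auto simp: has_bochner_integral_iff)
qed

section \<open>Exponential sums and the kernel of the split Mellin integral\<close>

definition exp_sum :: "(nat \<Rightarrow> real) \<Rightarrow> real \<Rightarrow> real" where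
  "exp_sum \<mu> t = (\<Sum>i. exp (- \<mu> i * t))"

text \<open>The sums stand for theta series without their constant term. For
  \<open>t \<le> 1\<close> the dual series at \<open>1 / t \<ge> 1\<close> is used, so that the
  kernel decays rapidly at 0 as well as at infinity.\<close>

definition mellin_kernel :: "(nat \<Rightarrow> real) \<Rightarrow> (nat \<Rightarrow> real) \<Rightarrow> real \<Rightarrow> real \<Rightarrow> real" where
  "mellin_kernel \<mu> \<nu> p t = (if t > 1 then exp_sum \<mu> t else t powr - p * exp_sum \<nu> (1 / t))"

lemma measurable_exp_sum [measurable]: "exp_sum \<mu> \<in> borel_measurable borel"
  unfolding exp_sum_def by measurable

lemma measurable_mellin_kernel [measurable]: "mellin_kernel \<mu> \<nu> p \<in> borel_measurable borel"
  unfolding mellin_kernel_def by measurable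

lemma exp_sum_nonneg: "summable (\<lambda>i. exp (- \<mu> i * t)) \<Longrightarrow> exp_sum \<mu> t \<ge> 0"
  unfolding exp_sum_def by (intro suminf_nonneg) auto

text \<open>As every exponent is at least \<open>m\<close>, the factor
  \<open>exp (- m * (t - 1))\<close> can be pulled out of each term, and what remains is bounded by
  the sum at 1.\<close>

lemma exp_sum_decay:
  assumes "\<And>i. m \<le> \<mu> i" "\<And>t. t > 0 \<Longrightarrow> summable (\<lambda>i. exp (- \<mu> i * t))" "t \<ge> 1"
  shows "exp_sum \<mu> t \<le> exp (- m * t) * (exp m * exp_sum \<mu> 1)"
proof -
  have "exp_sum \<mu> t \<le> (\<Sum>i. exp (- m * (t - 1)) * exp (- \<mu> i * 1))"
    unfolding exp_sum_def
  proof (intro suminf_le summable_mult assms)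
    fix i
    have "m * (t - 1) \<le> \<mu> i * (t - 1)" using assms by (intro mult_right_mono) auto
    then show "exp (- \<mu> i * t) \<le> exp (- m * (t - 1)) * exp (- \<mu> i * 1)"
      unfolding exp_add[symmetric] by (simp add: algebra_simps)
  qed (use assms in auto)
  also have "\<dots> = exp (- m * (t - 1)) * exp_sum \<mu> 1"
    unfolding exp_sum_def using assms(2)[of 1] by (intro suminf_mult) simp
  also have "exp (- m * (t - 1)) = exp (- m * t) * exp m"
    by (simp add: algebra_simps flip: exp_add)
  finally show ?thesis by (simp add: mult_ac)
qed

lemma mellin_kernel_nonneg:
  assumes "\<And>t. t > 0 \<Longrightarrow> summable (\<lambda>i. exp (- \<mu> i * t))"
    "\<And>t. t > 0 \<Longrightarrow> summable (\<lambda>i. exp (- \<nu> i * t))" "t > 0"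
  shows "mellin_kernel \<mu> \<nu> p t \<ge> 0"
  unfolding mellin_kernel_def using assms(3)
  by (auto intro!: exp_sum_nonneg mult_nonneg_nonneg assms(1,2))

text \<open>Exponential decay beats every power: directly for \<open>t > 1\<close>, and in the
  variable \<open>1 / t\<close> for \<open>t \<le> 1\<close>. Having this for all real \<sigma> is
  what makes the Mellin transform entire.\<close>

lemma mellin_kernel_integrable:
  assumes m: "m > 0" "\<And>i. m \<le> \<mu> i" "\<And>i. m \<le> \<nu> i"
    and summ: "\<And>t. t > 0 \<Longrightarrow> summable (\<lambda>i. exp (- \<mu> i * t))"
      "\<And>t. t > 0 \<Longrightarrow> summable (\<lambda>i. exp (- \<nu> i * t))"
  shows "integrable lborel (\<lambda>t. indicator {0<..} t * (t powr \<sigma> * mellin_kernel \<mu> \<nu> p t))"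
proof (rule integrable_rapid_decay)
  fix q :: real
  obtain C1 where C1: "\<And>x. x \<ge> 1 \<Longrightarrow> x powr q * exp (- m * x) \<le> C1"
    using powr_times_exp_bounded[OF m(1)] by blast
  obtain C2 where C2: "\<And>x. x \<ge> 1 \<Longrightarrow> x powr (p - q) * exp (- m * x) \<le> C2"
    using powr_times_exp_bounded[OF m(1)] by blast
  define D where "D = \<bar>C1 * (exp m * exp_sum \<mu> 1)\<bar> + \<bar>C2 * (exp m * exp_sum \<nu> 1)\<bar>"
  have "\<bar>t powr q * mellin_kernel \<mu> \<nu> p t\<bar> \<le> D" if "t > 0" for t
  proof -
    have "t powr q * mellin_kernel \<mu> \<nu> p t \<le> D"
    proof (cases "t > 1")
      case True
      have "t powr q * exp_sum \<mu> t \<le> t powr q * (exp (- m * t) * (exp m * exp_sum \<mu> 1))"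
        using True by (intro mult_left_mono exp_sum_decay m summ) auto
      also have "\<dots> = (t powr q * exp (- m * t)) * (exp m * exp_sum \<mu> 1)" by simp
      also have "\<dots> \<le> C1 * (exp m * exp_sum \<mu> 1)"
        using True by (intro mult_right_mono C1 mult_nonneg_nonneg exp_sum_nonneg summ) auto
      also have "\<dots> \<le> D" unfolding D_def by linarith
      finally show ?thesis using True by (simp add: mellin_kernel_def)
    next
      case False
      have t1: "1 / t \<ge> 1" using that False by simp
      have "t powr q * (t powr - p * exp_sum \<nu> (1 / t)) = (1 / t) powr (p - q) * exp_sum \<nu> (1 / t)"
        using that by (simp add: powr_divide powr_diff powr_minus field_simps)
      also have "\<dots> \<le> (1 / t) powr (p - q) * (exp (- m * (1 / t)) * (exp m * exp_sum \<nu> 1))"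
        using t1 by (intro mult_left_mono exp_sum_decay m summ) auto
      also have "\<dots> = ((1 / t) powr (p - q) * exp (- m * (1 / t))) * (exp m * exp_sum \<nu> 1)" by simp
      also have "\<dots> \<le> C2 * (exp m * exp_sum \<nu> 1)"
        by (intro mult_right_mono C2 mult_nonneg_nonneg exp_sum_nonneg summ t1) auto
      also have "\<dots> \<le> D" unfolding D_def by linarith
      finally show ?thesis using False by (simp add: mellin_kernel_def)
    qed
    moreover have "0 \<le> t powr q * mellin_kernel \<mu> \<nu> p t"
      using that by (intro mult_nonneg_nonneg mellin_kernel_nonneg summ) auto
    ultimately show ?thesis by simp
  qed
  then show "\<exists>C. \<forall>t>0. \<bar>t powr q * mellin_kernel \<mu> \<nu> p t\<bar> \<le> C" by blast
qed simp


section \<open>Analytic continuation for two exponential sums related by an inversion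
  formula\<close>

locale theta_pair =
  fixes \<mu> \<nu> :: "nat \<Rightarrow> real" and m p :: real
  assumes m_pos: "m > 0" and p_pos: "p > 0"
    and \<mu>_ge: "\<And>i. m \<le> \<mu> i" and \<nu>_ge: "\<And>i. m \<le> \<nu> i"
    and summable_\<mu>: "\<And>t. t > 0 \<Longrightarrow> summable (\<lambda>i. exp (- \<mu> i * t))"
    and summable_\<nu>: "\<And>t. t > 0 \<Longrightarrow> summable (\<lambda>i. exp (- \<nu> i * t))"
    and theta: "\<And>t. t > 0 \<Longrightarrow> 1 + exp_sum \<mu> t = t powr - p * (1 + exp_sum \<nu> (1 / t))"
begin

definition M :: "complex \<Rightarrow> complex" where
  "M s = (LINT t|lborel. indicator {0<..} t *\<^sub>R
            (complex_of_real t powr (s - 1) * of_real (mellin_kernel \<mu> \<nu> p t)))"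

text \<open>Riemann's expression \<open>(M s + 1 / (s - p) - 1 / s) / Gamma s\<close>, with
  \<open>rGamma s / s\<close> replaced by \<open>rGamma (s + 1)\<close>, so that no division by
  \<open>s\<close> is left and the formula is analytic at 0.\<close>

definition continued_zeta :: "complex \<Rightarrow> complex" where
  "continued_zeta s = rGamma s * (M s + 1 / (s - of_real p)) - rGamma (s + 1)"

lemma kernel_integrable:
  "integrable lborel (\<lambda>t. indicator {0<..} t * (t powr \<sigma> * mellin_kernel \<mu> \<nu> p t))"
  using m_pos \<mu>_ge \<nu>_ge summable_\<mu> summable_\<nu> by (rule mellin_kernel_integrable)

lemma kernel_nonneg: "t > 0 \<Longrightarrow> mellin_kernel \<mu> \<nu> p t \<ge> 0"
  by (intro mellin_kernel_nonneg summable_\<mu> summable_\<nu>)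

lemma M_holomorphic: "M holomorphic_on A"
proof -
  have "M holomorphic_on UNIV"
    unfolding M_def[abs_def] by (intro mellin_entire kernel_integrable measurable_mellin_kernel)
  then show ?thesis by (rule holomorphic_on_subset) simp
qed

text \<open>On the unit interval the inversion formula expresses the sum by the rapidly decaying
  kernel plus \<open>t powr - p - 1\<close>; the latter comes from the two constant terms and is
  what produces the poles.\<close>

lemma exp_sum_split:
  assumes "t > 0"
  shows "exp_sum \<mu> t = mellin_kernel \<mu> \<nu> p t + indicator {0<..1} t * (t powr - p - 1)"
  using theta[OF assms] assms by (auto simp: mellin_kernel_def algebra_simps)

text \<open>Integrate \<open>exp_sum \<mu>\<close> against \<open>t powr (s - 1)\<close> in two
  ways. Termwise, the \<open>i\<close>-th term yields \<open>Gamma s * \<mu> i powr - s\<close>;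
  through \<open>exp_sum_split\<close>, the total is \<open>M s + 1 / (s - p) - 1 / s\<close>.
  Absolute summability lets the series be read later as an unordered sum over the lattice.\<close>

lemma dirichlet_series:
  assumes s: "Re s > p"
  shows "summable (\<lambda>i. norm (complex_of_real (\<mu> i) powr - s))"
    and "(\<lambda>i. complex_of_real (\<mu> i) powr - s) sums continued_zeta s"
proof -
  define f where "f = (\<lambda>i t. indicator {0<..} t *\<^sub>R
            (complex_of_real t powr (s - 1) * of_real (exp (- \<mu> i * t))))"
  define k where "k = (\<lambda>t. indicator {0<..} t *\<^sub>R
            (complex_of_real t powr (s - 1) * of_real (mellin_kernel \<mu> \<nu> p t)))"
  define u where "u = (\<lambda>z t. indicator {0<..1} t *\<^sub>R (complex_of_real t powr (z - 1)))"
  have Re_pos: "Re s > 0" using s p_pos by simp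
  have \<mu>_pos: "\<mu> i > 0" for i using m_pos \<mu>_ge[of i] by simp
  have f: "has_bochner_integral lborel (f i) (Gamma s * of_real (\<mu> i) powr - s)" for i
    unfolding f_def by (rule has_bochner_integral_Gamma[OF \<mu>_pos Re_pos])
  have f_int: "integrable lborel (f i)" for i using f by (simp add: has_bochner_integral_iff)
  have u: "has_bochner_integral lborel (u s) (1 / s)"
    "has_bochner_integral lborel (u (s - of_real p)) (1 / (s - of_real p))"
    unfolding u_def by (intro has_bochner_integral_powr_unit; use s Re_pos in simp)+
  have k_norm: "norm (k t) = indicator {0<..} t * (t powr (Re s - 1) * mellin_kernel \<mu> \<nu> p t)" for t
    using kernel_nonneg[of t] by (auto simp: k_def norm_mult norm_powr_real_powr split: split_indicator)
  have [measurable]: "k \<in> borel_measurable borel" unfolding k_def by measurable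
  have k_int: "integrable lborel k"
    by (rule Bochner_Integration.integrable_bound[OF kernel_integrable[of "Re s - 1"]])
       (auto simp: k_norm)
  define G where "G = (\<lambda>t. k t + u (s - of_real p) t - u s t)"
  have G: "has_bochner_integral lborel G (M s + 1 / (s - of_real p) - 1 / s)"
    unfolding G_def using u k_int
    by (intro has_bochner_integral_add has_bochner_integral_diff) (auto simp: has_bochner_integral_iff M_def k_def)
  have G_int: "integrable lborel G" using G by (simp add: has_bochner_integral_iff)
  have f_norm: "norm (f i t) = indicator {0<..} t * (t powr (Re s - 1) * exp (- \<mu> i * t))" for i t
    by (auto simp: f_def norm_mult norm_powr_real_powr split: split_indicator)
  have G_eq: "G t = indicator {0<..} t *\<^sub>R (complex_of_real t powr (s - 1) * of_real (exp_sum \<mu> t))" for t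
  proof (cases "t > 0")
    case True
    have "complex_of_real t powr (s - of_real p - 1) = of_real t powr (s - 1) * of_real (t powr - p)"
      using True by (simp add: powr_of_real[symmetric] powr_add[symmetric] algebra_simps)
    then show ?thesis
      using True by (simp add: G_def exp_sum_split[OF True] k_def u_def algebra_simps split: split_indicator)
  qed (simp add: G_def k_def u_def)
  have f_sums: "(\<lambda>i. f i t) sums G t" for t
  proof (cases "t > 0")
    case True
    have "(\<lambda>i. exp (- \<mu> i * t)) sums exp_sum \<mu> t"
      unfolding exp_sum_def using summable_\<mu>[OF True] by (rule summable_sums)
    then have "(\<lambda>i. complex_of_real (exp (- \<mu> i * t))) sums of_real (exp_sum \<mu> t)"
      by (rule sums_of_real)
    then show ?thesis
      unfolding G_eq f_def by (intro sums_scaleR_right sums_mult)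
  qed (simp add: G_eq f_def)
  have G_norm: "norm (G t) = indicator {0<..} t * (t powr (Re s - 1) * exp_sum \<mu> t)" for t
    using exp_sum_nonneg[OF summable_\<mu>, of t]
    by (auto simp: G_eq norm_mult norm_powr_real_powr split: split_indicator)
  \<comment> \<open>All terms carry the same phase \<open>t powr (s - 1)\<close> and otherwise
    positive factors, so their norms add up exactly to the norm of the sum. Hence
    \<open>norm (G t)\<close> bounds all partial sums, and termwise integration is allowed.\<close>
  have f_nsums: "(\<lambda>i. norm (f i t)) sums norm (G t)" for t
  proof (cases "t > 0")
    case True
    show ?thesis unfolding G_norm f_norm exp_sum_def
      by (intro sums_mult summable_sums summable_\<mu> True)
  qed (simp add: G_norm f_norm)
  have summable: "summable (\<lambda>i. LINT t|lborel. norm (f i t))"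
  proof (rule bounded_imp_summable)
    fix n
    have "(\<Sum>i\<le>n. LINT t|lborel. norm (f i t)) = (LINT t|lborel. (\<Sum>i\<le>n. norm (f i t)))"
      by (intro Bochner_Integration.integral_sum[symmetric] integrable_norm f_int)
    also have "\<dots> \<le> (LINT t|lborel. norm (G t))"
    proof (intro integral_mono integrable_norm Bochner_Integration.integrable_sum f_int G_int)
      fix t
      show "(\<Sum>i\<le>n. norm (f i t)) \<le> norm (G t)"
        unfolding sums_unique[OF f_nsums[of t]]
        by (intro sum_le_suminf sums_summable[OF f_nsums]) auto
    qed
    finally show "(\<Sum>i\<le>n. LINT t|lborel. norm (f i t)) \<le> (LINT t|lborel. norm (G t))" .
  qed auto
  have Gamma_nz: "Gamma s \<noteq> 0"
    using Re_pos by (auto simp: Gamma_eq_zero_iff elim!: nonpos_Ints_cases)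
  have int_f: "(LINT t|lborel. f i t) = Gamma s * of_real (\<mu> i) powr - s" for i
    using f by (rule has_bochner_integral_integral_eq)
  show "summable (\<lambda>i. norm (complex_of_real (\<mu> i) powr - s))"
  proof (rule summable_comparison_test'[OF summable_mult[OF summable, of "inverse (norm (Gamma s))"]])
    fix i
    have "norm (Gamma s) * norm (complex_of_real (\<mu> i) powr - s) \<le> (LINT t|lborel. norm (f i t))"
      using integral_norm_bound[of lborel "f i"] by (simp add: int_f norm_mult)
    then show "norm (norm (complex_of_real (\<mu> i) powr - s)) \<le> inverse (norm (Gamma s)) * (LINT t|lborel. norm (f i t))"
      using Gamma_nz by (simp add: field_simps)
  qed
  have "(\<lambda>i. LINT t|lborel. f i t) sums (LINT t|lborel. (\<Sum>i. f i t))"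
    by (rule sums_integral[OF f_int _ summable]) (use f_nsums in \<open>auto simp: sums_iff\<close>)
  also have "(\<lambda>t. \<Sum>i. f i t) = G"
    using f_sums by (auto simp: sums_iff)
  also have "(LINT t|lborel. G t) = M s + 1 / (s - of_real p) - 1 / s"
    using G by (rule has_bochner_integral_integral_eq)
  finally have "(\<lambda>i. rGamma s * (Gamma s * of_real (\<mu> i) powr - s)) sums
      (rGamma s * (M s + 1 / (s - of_real p) - 1 / s))"
    unfolding int_f by (rule sums_mult)
  moreover have "rGamma s * (M s + 1 / (s - of_real p) - 1 / s) = continued_zeta s"

  proof -
    have "s \<noteq> 0" using Re_pos by auto
    then have "rGamma (s + 1) = rGamma s / s"
      using rGamma_plus1[of s] by (metis nonzero_mult_div_cancel_left)
    then show ?thesis by (simp add: continued_zeta_def algebra_simps)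
  qed
  ultimately show "(\<lambda>i. complex_of_real (\<mu> i) powr - s) sums continued_zeta s"
    using Gamma_nz by (simp add: rGamma_inverse_Gamma mult.assoc[symmetric])
qed

lemma continued_zeta_meromorphic: "continued_zeta meromorphic_on UNIV"
proof -
  have "M analytic_on UNIV" using M_holomorphic by (simp add: analytic_on_open)
  then show ?thesis unfolding continued_zeta_def[abs_def]
    by (intro meromorphic_intros analytic_on_imp_meromorphic_on[of M] analytic_on_imp_meromorphic_on[OF analytic_intros(1)])
       (auto intro!: analytic_on_imp_meromorphic_on analytic_intros analytic_rGamma)
qed

lemma continued_zeta_analytic_0: "continued_zeta analytic_on {0}"
proof -
  have "M analytic_on UNIV" using M_holomorphic by (simp add: analytic_on_open)
  then have "M analytic_on {0}" by (rule analytic_on_subset) simp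
  then show ?thesis unfolding continued_zeta_def[abs_def]
    using p_pos by (auto intro!: analytic_intros analytic_rGamma)
qed

text \<open>\<open>rGamma\<close> vanishes at 0, which leaves \<open>- rGamma 1\<close>. This value
  decides how rescaling the spectrum changes the derivative at 0.\<close>

lemma continued_zeta_0: "continued_zeta 0 = -1"
  by (simp add: continued_zeta_def)

text \<open>Because \<open>rGamma\<close> has value 0 and derivative 1 at 0, the product contributes
  only the value \<open>M 0 - 1 / p\<close>; the derivative of \<open>rGamma\<close> at 1 accounts
  for the Euler-Mascheroni constant.\<close>

lemma continued_zeta_deriv_0:
  "(continued_zeta has_field_derivative (M 0 - 1 / of_real p - euler_mascheroni)) (at 0)"
proof -
  have M: "(M has_field_derivative deriv M 0) (at 0)"
    using M_holomorphic[of UNIV] by (intro holomorphic_derivI[of _ UNIV]) auto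
  have r0: "((rGamma :: complex \<Rightarrow> complex) has_field_derivative 1) (at 0)"
    using has_field_derivative_rGamma_nonpos_int[of 0 UNIV] by simp
  have r1: "((\<lambda>s. rGamma (s + 1) :: complex) has_field_derivative euler_mascheroni) (at 0)"
    using DERIV_shift[of rGamma euler_mascheroni 0 "1::complex"]
      has_field_derivative_rGamma_no_nonpos_int[of "1::complex" UNIV] by (simp add: add.commute)
  show ?thesis unfolding continued_zeta_def[abs_def]
    using p_pos by (auto intro!: derivative_eq_intros M r0 r1)
qed

lemma M_0: "M 0 = of_real (LINT t|lborel. indicator {0<..} t * (t powr - 1 * mellin_kernel \<mu> \<nu> p t))"
proof -
  have "M 0 = (LINT t|lborel. complex_of_real (indicator {0<..} t * (t powr - 1 * mellin_kernel \<mu> \<nu> p t)))"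
    unfolding M_def
  proof (intro Bochner_Integration.integral_cong refl)
    fix t :: real
    show "indicator {0<..} t *\<^sub>R (complex_of_real t powr (0 - 1) * of_real (mellin_kernel \<mu> \<nu> p t)) =
        of_real (indicator {0<..} t * (t powr - 1 * mellin_kernel \<mu> \<nu> p t))"
      using powr_of_real[of t "-1"] by (auto split: split_indicator)
  qed
  then show ?thesis by (simp only: integral_complex_of_real)
qed

end

section \<open>The Jacobi theta function\<close>

text \<open>Being even, \<open>d\<close> is a continuous function of \<open>cos (2\<pi>u)\<close>, so Weierstrass approximation applies.\<close>

lemma even_cosine_moments_zero:
  fixes d :: "real \<Rightarrow> real"
  assumes cont: "continuous_on {-(1/2)..1/2} d"
    and even: "\<And>u. u \<in> {-(1/2)..1/2} \<Longrightarrow> d (- u) = d u"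
    and moments: "\<And>m::nat. integral {-(1/2)..1/2} (\<lambda>u. d u * cos (2 * pi * m * u)) = 0"
    and u: "u \<in> {-(1/2)..1/2}"
  shows "d u = 0"
proof -
  define I where "I = {-(1/2)..1/2::real}"
  have cont': "continuous_on I d" using cont by (simp add: I_def)
  have int: "f integrable_on I" if "continuous_on I f" for f :: "real \<Rightarrow> real"
    using that unfolding I_def by (rule integrable_continuous_real)
  \<comment> \<open>Induction on \<open>k\<close> for all frequencies at once: a factor
    \<open>cos (2 * pi * u)\<close> turns frequency \<open>m\<close> into the mean of
    \<open>m - 1\<close> and \<open>m + 1\<close>, and for \<open>m = 0\<close> it simply becomes
    frequency 1.\<close>
  have pow: "integral I (\<lambda>u. d u * cos (2 * pi * m * u) * cos (2 * pi * u) ^ k) = 0" for m k :: nat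
  proof (induction k arbitrary: m)
    case 0
    show ?case using moments[of m] by (simp add: I_def)
  next
    case (Suc k)
    show ?case
    proof (cases m)
      case 0
      show ?thesis using Suc[of 1] 0 by (simp add: mult_ac)
    next
      case (Suc j)
      have eq: "d u * cos (2 * pi * m * u) * cos (2 * pi * u) ^ Suc k =
          (1/2) * (d u * cos (2 * pi * j * u) * cos (2 * pi * u) ^ k)
          + (1/2) * (d u * cos (2 * pi * Suc m * u) * cos (2 * pi * u) ^ k)" for u
      proof -
        have "cos (2 * pi * m * u) * cos (2 * pi * u) =
            (cos (2 * pi * j * u) + cos (2 * pi * Suc m * u)) / 2"
          unfolding cos_times_cos by (simp add: Suc algebra_simps)
        then have "d u * (cos (2 * pi * m * u) * cos (2 * pi * u)) * cos (2 * pi * u) ^ k =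
           d u * ((cos (2 * pi * j * u) + cos (2 * pi * Suc m * u)) / 2) * cos (2 * pi * u) ^ k"
          by simp
        then show ?thesis by (simp add: algebra_simps)
      qed
      have "integral I (\<lambda>u. d u * cos (2 * pi * m * u) * cos (2 * pi * u) ^ Suc k) =
          integral I (\<lambda>u. (1/2) * (d u * cos (2 * pi * j * u) * cos (2 * pi * u) ^ k))
          + integral I (\<lambda>u. (1/2) * (d u * cos (2 * pi * Suc m * u) * cos (2 * pi * u) ^ k))"
        unfolding eq by (intro Henstock_Kurzweil_Integration.integral_add int continuous_intros cont')
      also have "\<dots> = 0"
        unfolding Henstock_Kurzweil_Integration.integral_mult_right Suc.IH by simp
      finally show ?thesis .
    qed
  qed
  \<comment> \<open>\<open>arccos y / (2 * pi)\<close> inverts the cosine only on the half period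
    from 0 to 1/2; evenness of \<open>d\<close> covers the other half.\<close>
  define h where "h = (\<lambda>y. d (arccos y / (2 * pi)))"
  have h_cont: "continuous_on {-1..1} h"
    unfolding h_def
  proof (rule continuous_on_compose2[OF cont])
    show "(\<lambda>y. arccos y / (2 * pi)) ` {- 1..1} \<subseteq> {- (1 / 2)..1 / 2}"
    proof safe
      fix y :: real assume "y \<in> {-1..1}"
      then have "0 \<le> arccos y" "arccos y \<le> pi" by (auto intro: arccos_lbound arccos_ubound)
      then show "arccos y / (2 * pi) \<in> {- (1 / 2)..1 / 2}"
        using order_trans[of "- 1 / 2" 0 "arccos y / (2 * pi)"] by (simp add: pos_divide_le_eq)
    qed
  qed (auto intro!: continuous_intros)
  have h_cos: "h (cos (2 * pi * v)) = d v" if "v \<in> I" for v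
  proof -
    have "arccos (cos (2 * pi * \<bar>v\<bar>)) = 2 * pi * \<bar>v\<bar>"
      using that by (intro arccos_cos) (auto simp: I_def abs_le_iff)
    moreover have "cos (2 * pi * \<bar>v\<bar>) = cos (2 * pi * v)" by (cases "v \<ge> 0") auto
    ultimately have "h (cos (2 * pi * v)) = d \<bar>v\<bar>" by (simp add: h_def)
    also have "d \<bar>v\<bar> = d v" using even[of v] that by (cases "v \<ge> 0") (auto simp: I_def)
    finally show ?thesis .
  qed
  define N where "N = integral I (\<lambda>v. \<bar>d v\<bar>)"
  have N: "N \<ge> 0" unfolding N_def by (intro Henstock_Kurzweil_Integration.integral_nonneg int continuous_intros cont') auto
  \<comment> \<open>A polynomial in the cosine is orthogonal to \<open>d\<close>, so it may be
    subtracted from one factor of \<open>d v * d v\<close>; with an approximation within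
    \<open>e\<close> only \<open>e * N\<close> remains.\<close>
  have le: "integral I (\<lambda>v. d v * d v) \<le> e * N" if e: "e > 0" for e
  proof -
    obtain g where g: "real_polynomial_function g" "\<And>y. y \<in> {-1..1} \<Longrightarrow> \<bar>h y - g y\<bar> < e"
      using Stone_Weierstrass_real_polynomial_function[of "{-1..1}" h e] h_cont e by auto
    obtain a n where a: "g = (\<lambda>y. \<Sum>i\<le>n. a i * y ^ i)"
      using g(1) unfolding real_polynomial_function_iff_sum by blast
    have cont_g: "continuous_on I (\<lambda>v. g (cos (2 * pi * v)))"
      unfolding a by (intro continuous_intros)
    have zero: "integral I (\<lambda>v. d v * g (cos (2 * pi * v))) = 0"
    proof -
      have "integral I (\<lambda>v. d v * g (cos (2 * pi * v))) =
          integral I (\<lambda>v. \<Sum>i\<le>n. a i * (d v * cos (2 * pi * v) ^ i))"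
        by (simp add: a sum_distrib_left mult_ac)
      also have "\<dots> = (\<Sum>i\<le>n. integral I (\<lambda>v. a i * (d v * cos (2 * pi * v) ^ i)))"
        by (intro Henstock_Kurzweil_Integration.integral_sum int continuous_intros cont') auto
      also have "\<dots> = 0"
        using pow[of 0] by (intro sum.neutral) simp
      finally show ?thesis .
    qed
    have "integral I (\<lambda>v. d v * d v) =
        integral I (\<lambda>v. d v * (d v - g (cos (2 * pi * v)))) + integral I (\<lambda>v. d v * g (cos (2 * pi * v)))"
    proof -
      have "integral I (\<lambda>v. d v * (d v - g (cos (2 * pi * v))) + d v * g (cos (2 * pi * v))) =
        integral I (\<lambda>v. d v * (d v - g (cos (2 * pi * v)))) + integral I (\<lambda>v. d v * g (cos (2 * pi * v)))"
        by (intro Henstock_Kurzweil_Integration.integral_add int continuous_on_mult continuous_on_diff cont' cont_g)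
      then show ?thesis by (simp add: right_diff_distrib)
    qed
    also have "\<dots> = integral I (\<lambda>v. d v * (d v - g (cos (2 * pi * v))))"
      by (simp add: zero)
    also have "\<dots> \<le> integral I (\<lambda>v. e * \<bar>d v\<bar>)"
    proof (intro integral_le int continuous_intros cont' cont_g)
      fix v assume v: "v \<in> I"
      have "\<bar>d v - g (cos (2 * pi * v))\<bar> \<le> e"
        using g(2)[of "cos (2 * pi * v)"] h_cos[OF v] by simp
      then have "\<bar>d v\<bar> * \<bar>d v - g (cos (2 * pi * v))\<bar> \<le> \<bar>d v\<bar> * e"
        by (intro mult_left_mono) auto
      then show "d v * (d v - g (cos (2 * pi * v))) \<le> e * \<bar>d v\<bar>"
        using abs_ge_self[of "d v * (d v - g (cos (2 * pi * v)))"] by (simp add: abs_mult mult.commute)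
    qed
    finally show ?thesis by (simp add: N_def)
  qed
  have "integral I (\<lambda>v. d v * d v) \<le> 0 + \<epsilon>" if "\<epsilon> > 0" for \<epsilon>
  proof -
    have "\<epsilon> / (N + 1) * N \<le> \<epsilon>" using that N by (simp add: divide_simps)
    then show ?thesis using le[of "\<epsilon> / (N + 1)"] that N by simp
  qed
  then have "integral I (\<lambda>v. d v * d v) \<le> 0" by (rule field_le_epsilon)
  moreover have "integral I (\<lambda>v. d v * d v) \<ge> 0"
    by (intro Henstock_Kurzweil_Integration.integral_nonneg int continuous_intros cont') auto
  ultimately have "integral I (\<lambda>v. d v * d v) = 0" by simp
  then have "\<forall>v\<in>{-(1/2)..1/2}. d v * d v = 0"
    unfolding I_def by (subst (asm) integral_eq_0_iff) (auto intro!: continuous_intros cont)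
  then show ?thesis using u by simp
qed

text \<open>Real part of the characteristic function of the standard normal distribution, after
  rescaling the variable.\<close>

lemma gaussian_cosine_integral:
  fixes x t :: real
  assumes x: "x > 0"
  shows "has_bochner_integral lborel (\<lambda>v. exp (- pi * x * v\<^sup>2) * cos (t * v))
           (x powr - (1/2) * exp (- t\<^sup>2 / (4 * pi * x)))"
proof -
  \<comment> \<open>Chosen so that \<open>(c * v)\<^sup>2 / 2 = pi * x * v\<^sup>2\<close>; then
    \<open>s = t / c\<close> restores the frequency, as \<open>s * (c * v) = t * v\<close>.\<close>
  define c where "c = sqrt (2 * pi * x)"
  have c: "c > 0" "c\<^sup>2 = 2 * pi * x" using x by (simp_all add: c_def)
  define s where "s = t / c"
  have int: "integrable std_normal_distribution (\<lambda>y. iexp (s * y))"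
    by (rule prob_space.integrable_iexp[OF real_distribution.axioms(1)[OF real_dist_normal_dist]]) auto
  have "integrable std_normal_distribution (\<lambda>y. Re (iexp (s * y)))"
    using int by (rule integrable_Re)
  moreover have "(LINT y|std_normal_distribution. Re (iexp (s * y))) = exp (- s\<^sup>2 / 2)"
  proof -
    have "(LINT y|std_normal_distribution. iexp (s * y)) = of_real (exp (- s\<^sup>2 / 2))"
      by (rule trans[OF meta_eq_to_obj_eq[OF char_def, symmetric] fun_cong[OF char_std_normal_distribution]])
    then show ?thesis
      by (subst integral_Re[OF int]) (simp only: Re_complex_of_real)
  qed
  ultimately have "has_bochner_integral std_normal_distribution (\<lambda>y. cos (s * y)) (exp (- s\<^sup>2 / 2))"
    by (simp add: has_bochner_integral_iff Re_exp)
  then have "has_bochner_integral lborel (\<lambda>y. std_normal_density y * cos (s * y)) (exp (- s\<^sup>2 / 2))"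
    by (simp add: has_bochner_integral_iff integral_density integrable_density normal_density_nonneg)
  then have "has_bochner_integral lborel (\<lambda>v. std_normal_density (0 + c * v) * cos (s * (0 + c * v)))
      (exp (- s\<^sup>2 / 2) /\<^sub>R \<bar>c\<bar>)"
    using c(1) by (subst (asm) lborel_has_bochner_integral_real_affine_iff[of c _ _ 0]) auto
  then have "has_bochner_integral lborel
      (\<lambda>v. sqrt (2 * pi) * (std_normal_density (0 + c * v) * cos (s * (0 + c * v))))
      (sqrt (2 * pi) * (exp (- s\<^sup>2 / 2) /\<^sub>R \<bar>c\<bar>))"
    by (rule has_bochner_integral_mult_right)
  also have "(\<lambda>v. sqrt (2 * pi) * (std_normal_density (0 + c * v) * cos (s * (0 + c * v)))) =
      (\<lambda>v. exp (- pi * x * v\<^sup>2) * cos (t * v))"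
  proof
    fix v
    have "(c * v)\<^sup>2 = 2 * (pi * x * v\<^sup>2)" and st: "s * (c * v) = t * v"
      using c by (simp_all add: power_mult_distrib s_def)
    then have "sqrt (2 * pi) * std_normal_density (c * v) = exp (- pi * x * v\<^sup>2)"
      by (simp add: std_normal_density_def)
    then show "sqrt (2 * pi) * (std_normal_density (0 + c * v) * cos (s * (0 + c * v))) =
        exp (- pi * x * v\<^sup>2) * cos (t * v)"
      unfolding add_0 st by simp
  qed
  also have "sqrt (2 * pi) * (exp (- s\<^sup>2 / 2) /\<^sub>R \<bar>c\<bar>) = x powr - (1/2) * exp (- t\<^sup>2 / (4 * pi * x))"
  proof -
    have "exp (- s\<^sup>2 / 2) = exp (- t\<^sup>2 / (4 * pi * x))"
      by (simp add: s_def power_divide c)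
    moreover have "sqrt (2 * pi) / \<bar>c\<bar> = x powr - (1/2)"
    proof -
      have "x powr - (1/2) = inverse (sqrt x)"
        using x by (simp only: powr_minus) (simp add: powr_half_sqrt)
      then show ?thesis
        using x by (simp add: c_def real_sqrt_mult field_simps)
    qed
    moreover have "sqrt (2 * pi) * (exp (- s\<^sup>2 / 2) /\<^sub>R \<bar>c\<bar>) = sqrt (2 * pi) / \<bar>c\<bar> * exp (- s\<^sup>2 / 2)"
      by (simp only: real_scaleR_def divide_inverse mult.assoc)
    ultimately show ?thesis by (simp only:)
  qed
  finally show ?thesis .
qed

section \<open>The theta series, its inversion formula and its continuity\<close>

definition jacobi_theta :: "real \<Rightarrow> real" where
  "jacobi_theta x = 1 + 2 * (\<Sum>k. exp (- pi * (real (Suc k))\<^sup>2 * x))"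

lemma exp_geometric_le:
  fixes y :: real
  assumes "y > 0" "real k \<le> q"
  shows "exp (- y * q) \<le> exp (- y) ^ k"
proof -
  have "exp (- y) ^ k = exp (- y * real k)"
    by (simp add: exp_of_nat_mult[symmetric] mult.commute)
  also have "\<dots> \<ge> exp (- y * q)" using assms by (simp add: mult_left_mono)
  finally show ?thesis .
qed

lemma summable_exp_geometric: "y > 0 \<Longrightarrow> summable (\<lambda>k. exp (- y :: real) ^ k)"
  by (intro summable_geometric) simp

lemma le_Suc_square: "real k \<le> (real (Suc k))\<^sup>2"
  by (simp add: power2_eq_square algebra_simps)

lemma jacobi_theta_term_le:
  assumes "x > 0"
  shows "exp (- pi * (real (Suc k))\<^sup>2 * x) \<le> exp (- (pi * x)) ^ k"
  using exp_geometric_le[OF _ le_Suc_square, of "pi * x" k] assms by (simp add: mult_ac)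

lemma summable_jacobi_theta:
  assumes "x > 0"
  shows "summable (\<lambda>k. exp (- pi * (real (Suc k))\<^sup>2 * x))"
  by (rule summable_comparison_test'[OF summable_exp_geometric[of "pi * x"]])
     (use jacobi_theta_term_le assms in auto)

text \<open>The product is half the sum of the cosines of frequencies \<open>k - m\<close> and
  \<open>k + m\<close>. A nonzero integer frequency integrates to 0 over a period, and
  \<open>k > 0\<close> keeps \<open>k + m\<close> nonzero.\<close>

lemma cos_product_integral:
  fixes k m :: nat
  assumes "k > 0"
  shows "integral {-(1/2)..1/2} (\<lambda>u. cos (2 * pi * k * u) * cos (2 * pi * m * u)) = (if k = m then 1/2 else 0)"
proof -
  have int_cos: "((\<lambda>u. cos (2 * pi * of_int j * u)) has_integral (if j = 0 then 1 else 0)) {-(1/2)..1/2}" for j :: int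
  proof (cases "j = 0")
    case True
    then show ?thesis using has_integral_const_real[of "1::real" "-(1/2)" "1/2"] by simp
  next
    case False
    have "((\<lambda>u. cos (2 * pi * of_int j * u)) has_integral
        (sin (2 * pi * of_int j * (1/2)) / (2 * pi * of_int j) - sin (2 * pi * of_int j * (-(1/2))) / (2 * pi * of_int j))) {-(1/2)..1/2}"
      using False by (intro fundamental_theorem_of_calculus)
        (auto intro!: derivative_eq_intros simp: has_real_derivative_iff_has_vector_derivative[symmetric])
    moreover have "sin (2 * pi * of_int j * (1/2)) = 0"
      using sin_int_times_real[of j "0"] sin_npi_int[of j] by (simp add: mult.commute)
    ultimately show ?thesis using False by simp
  qed
  have eq: "cos (2 * pi * k * u) * cos (2 * pi * m * u) =
      (1/2) * cos (2 * pi * of_int (int k - int m) * u) + (1/2) * cos (2 * pi * of_int (int k + int m) * u)" for u :: real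
    unfolding cos_times_cos by (simp add: algebra_simps)
  have "((\<lambda>u. cos (2 * pi * k * u) * cos (2 * pi * m * u)) has_integral
      (1/2) * (if int k - int m = 0 then 1 else 0) + (1/2) * (if int k + int m = 0 then 1 else 0)) {-(1/2)..1/2}"
    unfolding eq by (intro has_integral_add has_integral_mult_right int_cos)
  then show ?thesis using assms by (auto dest!: integral_unique)
qed

text \<open>Poisson summation for a Gaussian. Its periodization and the Fourier series with
  coefficients from \<open>gaussian_cosine_integral\<close> are even, and their difference is
  continuous with vanishing cosine moments; so \<open>even_cosine_moments_zero\<close> makes them
  agree, and evaluation at 0 gives the formula.\<close>

theorem jacobi_theta_inversion:
  assumes x: "x > 0"
  shows "jacobi_theta x = x powr - (1/2) * jacobi_theta (1 / x)"
proof -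
  define I where "I = {-(1/2)..1/2::real}"
  define G where "G = (\<lambda>v. exp (- pi * x * v\<^sup>2))"
  define c where "c = x powr - (1/2)"
  \<comment> \<open>\<open>P k\<close> collects the translates of \<open>G\<close> by
    \<open>k + 1\<close> in both directions, \<open>R k\<close> is the Fourier mode of frequency
    \<open>k + 1\<close>, and \<open>c\<close> is the mode of frequency 0.\<close>
  define P where "P = (\<lambda>k u. G (u + real (Suc k)) + G (u - real (Suc k)))"
  define R where "R = (\<lambda>k u. 2 * c * exp (- pi * (real (Suc k))\<^sup>2 * (1 / x)) * cos (2 * pi * Suc k * u))"
  define S where "S = (\<lambda>n u. (G u - c) + (\<Sum>k<n. P k u - R k u))"
  define d where "d = (\<lambda>u. (G u - c) + (\<Sum>k. P k u - R k u))"
  have c: "c > 0" using x by (simp add: c_def)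
  have G_even: "G (- v) = G v" for v by (simp add: G_def)
  have [continuous_intros]: "continuous_on A (\<lambda>u. G (f u))" if "continuous_on A f" for A and f :: "real \<Rightarrow> real"
    unfolding G_def by (intro continuous_intros that)
  have G_int: "(\<lambda>v. G v * cos (2 * pi * m * v)) integrable_on {a..b}" for a b and m :: nat
    by (intro integrable_continuous_real continuous_intros)
  define B where "B = (\<lambda>k. 2 * exp (- (pi * x)) ^ k + 2 * c * exp (- (pi * (1 / x))) ^ k)"
  have B: "summable B"
    unfolding B_def using x by (intro summable_add summable_mult summable_exp_geometric) auto
  have bound: "norm (P k u - R k u) \<le> B k" if u: "u \<in> I" for k u
  proof -
    \<comment> \<open>For \<open>u\<close> in \<open>I\<close> the point \<open>u\<close> shifted by
      \<open>k + 1\<close> either way has modulus at least \<open>k + 1/2\<close>, and the square of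
      that is at least \<open>k\<close>: this gives geometric decay.\<close>
    have sq: "real k \<le> v\<^sup>2" if "\<bar>v\<bar> \<ge> real k + 1/2" for v :: real
    proof -
      have "(real k + 1/2)\<^sup>2 \<le> \<bar>v\<bar>\<^sup>2" using that by (intro power_mono) auto
      moreover have "(real k + 1/2)\<^sup>2 = (real k)\<^sup>2 + real k + 1/4"
        by (simp add: power2_eq_square algebra_simps)
      ultimately show ?thesis using zero_le_power2[of "real k"] by (simp only: power2_abs)
    qed
    have "G (u + real (Suc k)) \<le> exp (- (pi * x)) ^ k"
      using exp_geometric_le[of "pi * x" k "(u + real (Suc k))\<^sup>2"] sq[of "u + real (Suc k)"] x u
      by (simp add: G_def I_def)
    moreover have "G (u - real (Suc k)) \<le> exp (- (pi * x)) ^ k"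
      using exp_geometric_le[of "pi * x" k "(u - real (Suc k))\<^sup>2"] sq[of "u - real (Suc k)"] x u
      by (simp add: G_def I_def)
    moreover have "P k u \<ge> 0" by (simp add: P_def G_def add_nonneg_nonneg)
    ultimately have 1: "\<bar>P k u\<bar> \<le> 2 * exp (- (pi * x)) ^ k" by (simp add: P_def)
    have "\<bar>R k u\<bar> = 2 * c * exp (- pi * (real (Suc k))\<^sup>2 * (1 / x)) * \<bar>cos (2 * pi * Suc k * u)\<bar>"
      using c by (simp add: R_def abs_mult)
    also have "\<dots> \<le> 2 * c * exp (- (pi * (1 / x))) ^ k * 1"
      using c x by (intro mult_mono mult_left_mono jacobi_theta_term_le) auto
    finally show ?thesis using 1 by (simp add: B_def)
  qed
  \<comment> \<open>\<open>d\<close> is the periodized Gaussian minus its Fourier series; all its cosine moments vanish.\<close>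
  have unif: "uniform_limit I S d sequentially"
    unfolding S_def d_def
    by (intro uniform_limit_intros Weierstrass_m_test[OF bound B])
  have S_cont: "continuous_on I (S n)" for n
    unfolding S_def P_def R_def by (intro continuous_intros)
  have d_cont: "continuous_on I d"
    by (rule uniform_limit_theorem[OF always_eventually[OF allI[OF S_cont]] unif]) simp
  \<comment> \<open>The cosine has period 1, so the integral of a translate over \<open>I\<close> is
    an integral of \<open>G\<close> itself over a translate of \<open>I\<close>; these intervals
    tile the one on the right.\<close>
  have G_combine: "integral I (\<lambda>u. (G u + (\<Sum>k<n. P k u)) * cos (2 * pi * m * u)) =
      integral {-(real n + 1/2)..real n + 1/2} (\<lambda>v. G v * cos (2 * pi * m * v))" for n m :: nat
  proof (induction n)
    case (Suc n)
    let ?g = "\<lambda>v. G v * cos (2 * pi * m * v)"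
    have per: "cos (2 * pi * m * (real j + u)) = cos (2 * pi * m * u)"
       "cos (2 * pi * m * (- real j + u)) = cos (2 * pi * m * u)" for u j
    proof -
      have "2 * pi * m * (real j + u) = 2 * pi * m * u + 2 * pi * of_int (int (m * j))"
        "2 * pi * m * (- real j + u) = 2 * pi * m * u - 2 * pi * of_int (int (m * j))"
        by (simp_all add: algebra_simps)
      then show "cos (2 * pi * m * (real j + u)) = cos (2 * pi * m * u)"
       "cos (2 * pi * m * (- real j + u)) = cos (2 * pi * m * u)"
        using cos_int_2pin[of "int (m * j)"] sin_int_2pin[of "int (m * j)"]
        by (simp_all only: cos_add cos_diff mult_1_right mult_zero_right add_0_right diff_0_right)
    qed
    have 1: "integral I (\<lambda>u. G (u + real (Suc n)) * cos (2 * pi * m * u)) = integral {real n + 1/2..real (Suc n) + 1/2} ?g"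
    proof -
      have "(?g \<circ> (+) (real (Suc n))) = (\<lambda>u. G (u + real (Suc n)) * cos (2 * pi * m * u))"
        unfolding o_def per by (simp add: add_ac)
      moreover have "-(1/2) + real (Suc n) = real n + 1/2" "1/2 + real (Suc n) = real (Suc n) + 1/2"
        by simp_all
      ultimately show ?thesis
        using integral_shift_cbox_plus[of "-(1/2)" "1/2" ?g "real (Suc n)"]
        unfolding I_def cbox_interval by (simp only:)
    qed
    have 2: "integral I (\<lambda>u. G (u - real (Suc n)) * cos (2 * pi * m * u)) = integral {-(real (Suc n) + 1/2)..-(real n + 1/2)} ?g"
    proof -
      have "(?g \<circ> (+) (- real (Suc n))) = (\<lambda>u. G (u - real (Suc n)) * cos (2 * pi * m * u))"
        unfolding o_def per by (simp add: algebra_simps)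
      moreover have "-(1/2) + - real (Suc n) = -(real (Suc n) + 1/2)" "1/2 + - real (Suc n) = -(real n + 1/2)"
        by simp_all
      ultimately show ?thesis
        using integral_shift_cbox_plus[of "-(1/2)" "1/2" ?g "- real (Suc n)"]
        unfolding I_def cbox_interval by (simp only:)
    qed
    have "integral I (\<lambda>u. (G u + (\<Sum>k<Suc n. P k u)) * cos (2 * pi * m * u)) =
      integral I (\<lambda>u. (G u + (\<Sum>k<n. P k u)) * cos (2 * pi * m * u) +
         (G (u + real (Suc n)) * cos (2 * pi * m * u) + G (u - real (Suc n)) * cos (2 * pi * m * u)))"
      by (simp add: P_def algebra_simps)
    also have "\<dots> = integral I (\<lambda>u. (G u + (\<Sum>k<n. P k u)) * cos (2 * pi * m * u)) +
       integral I (\<lambda>u. G (u + real (Suc n)) * cos (2 * pi * m * u) + G (u - real (Suc n)) * cos (2 * pi * m * u))"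
      unfolding I_def P_def
      by (intro Henstock_Kurzweil_Integration.integral_add integrable_continuous_real continuous_intros)
    also have "integral I (\<lambda>u. G (u + real (Suc n)) * cos (2 * pi * m * u) + G (u - real (Suc n)) * cos (2 * pi * m * u))
       = integral {real n + 1/2..real (Suc n) + 1/2} ?g + integral {-(real (Suc n) + 1/2)..-(real n + 1/2)} ?g"
      unfolding 1[symmetric] 2[symmetric] unfolding I_def
      by (intro Henstock_Kurzweil_Integration.integral_add integrable_continuous_real continuous_intros)
    also note Suc.IH
    also have "integral {-(real n + 1/2)..real n + 1/2} ?g +
        (integral {real n + 1/2..real (Suc n) + 1/2} ?g + integral {-(real (Suc n) + 1/2)..-(real n + 1/2)} ?g)
        = integral {-(real (Suc n) + 1/2)..real (Suc n) + 1/2} ?g"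
      using Henstock_Kurzweil_Integration.integral_combine[of "-(real n + 1/2)" "real n + 1/2" "real (Suc n) + 1/2" ?g]
        Henstock_Kurzweil_Integration.integral_combine[of "-(real (Suc n) + 1/2)" "-(real n + 1/2)" "real (Suc n) + 1/2" ?g]
      by (simp add: G_int)
    finally show ?case .
  qed (simp add: I_def)
  \<comment> \<open>By orthogonality only the mode with \<open>Suc k = m\<close> survives;
    \<open>n \<ge> m\<close> guarantees that it is among the first \<open>n\<close>. For
    \<open>m = 0\<close> the constant \<open>c\<close> remains.\<close>
  have R_int: "integral I (\<lambda>u. (c + (\<Sum>k<n. R k u)) * cos (2 * pi * m * u)) = c * exp (- pi * (real m)\<^sup>2 * (1 / x))"
    if n: "n \<ge> m" for m n :: nat
  proof -
    have "integral I (\<lambda>u. (c + (\<Sum>k<n. R k u)) * cos (2 * pi * m * u)) =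
        integral I (\<lambda>u. c * cos (2 * pi * m * u) + (\<Sum>k<n. R k u * cos (2 * pi * m * u)))"
      by (simp add: algebra_simps sum_distrib_right)
    also have "\<dots> = integral I (\<lambda>u. c * cos (2 * pi * m * u)) + (\<Sum>k<n. integral I (\<lambda>u. R k u * cos (2 * pi * m * u)))"
      unfolding I_def R_def
      by (subst Henstock_Kurzweil_Integration.integral_sum[symmetric])
         (intro Henstock_Kurzweil_Integration.integral_add integrable_continuous_real continuous_intros finite_lessThan)+
    also have "(\<Sum>k<n. integral I (\<lambda>u. R k u * cos (2 * pi * m * u))) =
        (\<Sum>k<n. 2 * c * exp (- pi * (real (Suc k))\<^sup>2 * (1 / x)) * (if Suc k = m then 1/2 else 0))"
    proof (intro sum.cong refl)
      fix k
      show "integral I (\<lambda>u. R k u * cos (2 * pi * m * u)) =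
         2 * c * exp (- pi * (real (Suc k))\<^sup>2 * (1 / x)) * (if Suc k = m then 1/2 else 0)"
        unfolding cos_product_integral[of "Suc k" m, OF zero_less_Suc, symmetric] R_def I_def
        by (subst Henstock_Kurzweil_Integration.integral_mult_right[symmetric]) (simp only: mult.assoc)
    qed
    also have "\<dots> = (if m = 0 then 0 else c * exp (- pi * (real m)\<^sup>2 * (1 / x)))"
    proof (cases m)
      case (Suc j)
      then have "(\<Sum>k<n. 2 * c * exp (- pi * (real (Suc k))\<^sup>2 * (1 / x)) * (if Suc k = m then 1/2 else 0))
         = (\<Sum>k<n. if k = j then 2 * c * exp (- pi * (real (Suc k))\<^sup>2 * (1 / x)) * (1/2) else 0)"
        by (intro sum.cong) auto
      then show ?thesis using Suc n by simp
    qed simp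
    also have "integral I (\<lambda>u. c * cos (2 * pi * m * u)) = (if m = 0 then c else 0)"
      using cos_product_integral[of m 0] by (cases "m = 0") (auto simp: I_def)
    finally show ?thesis by simp
  qed
  \<comment> \<open>Dominated convergence to the full Gaussian integral with frequency
    \<open>2 * pi * m\<close>, whose exponent \<open>(2 * pi * m)\<^sup>2 / (4 * pi * x)\<close>
    equals \<open>pi * m\<^sup>2 / x\<close>.\<close>
  have G_lim: "(\<lambda>n. integral {-(real n + 1/2)..real n + 1/2} (\<lambda>v. G v * cos (2 * pi * m * v)))
      \<longlonglongrightarrow> c * exp (- pi * (real m)\<^sup>2 * (1 / x))" for m :: nat
  proof -
    define g where "g = (\<lambda>v. G v * cos (2 * pi * m * v))"
    have g: "has_bochner_integral lborel g (c * exp (- (2 * pi * m)\<^sup>2 / (4 * pi * x)))"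
      unfolding g_def G_def c_def by (rule gaussian_cosine_integral[OF x])
    have g_int: "integrable lborel g" and g_val: "integral\<^sup>L lborel g = c * exp (- (2 * pi * m)\<^sup>2 / (4 * pi * x))"
      using g by (auto simp: has_bochner_integral_iff)
    have [measurable]: "g \<in> borel_measurable borel" using g_int by simp
    have "(\<lambda>n. LINT v|lborel. indicator {-(real n + 1/2)..real n + 1/2} v * g v) \<longlonglongrightarrow> integral\<^sup>L lborel g"
    proof (rule integral_dominated_convergence[where w = "\<lambda>v. \<bar>g v\<bar>"])
      show "AE v in lborel. (\<lambda>n. indicator {-(real n + 1/2)..real n + 1/2} v * g v) \<longlonglongrightarrow> g v"
      proof (rule AE_I2)
        fix v :: real
        obtain N :: nat where N: "\<bar>v\<bar> \<le> real N" using real_arch_simple by blast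
        have "eventually (\<lambda>n. indicator {-(real n + 1/2)..real n + 1/2} v * g v = g v) sequentially"
          using eventually_ge_at_top[of N]
        proof eventually_elim
          case (elim n)
          then have "real N \<le> real n" by simp
          then have "v \<in> {-(real n + 1/2)..real n + 1/2}" using N by auto
          then show ?case by simp
        qed
        then show "(\<lambda>n. indicator {-(real n + 1/2)..real n + 1/2} v * g v) \<longlonglongrightarrow> g v"
          by (rule tendsto_eventually)
      qed
    qed (use g_int in \<open>auto split: split_indicator\<close>)
    moreover have "(LINT v|lborel. indicator {-(real n + 1/2)..real n + 1/2} v * g v) =
        integral {-(real n + 1/2)..real n + 1/2} g" for n
    proof -
      have "set_integrable lborel {-(real n + 1/2)..real n + 1/2} g"
        unfolding set_integrable_def by (intro integrable_mult_indicator g_int) auto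
      from set_borel_integral_eq_integral(2)[OF this] show ?thesis
        by (simp add: set_lebesgue_integral_def)
    qed
    moreover have "(2 * pi * m)\<^sup>2 / (4 * pi * x) = pi * (real m)\<^sup>2 * (1 / x)"
      using x by (simp add: power2_eq_square field_simps)
    ultimately show ?thesis unfolding g_def[symmetric] g_val by simp
  qed
  \<comment> \<open>Uniform convergence gives convergence of moments. The moment of
    \<open>S n\<close> is the difference of the integrals in \<open>G_combine\<close> and, once
    \<open>n \<ge> m\<close>, \<open>R_int\<close>; both have the same limit.\<close>
  have moments: "integral I (\<lambda>u. d u * cos (2 * pi * m * u)) = 0" for m :: nat
  proof -
    have cosb: "bounded ((\<lambda>u. cos (2 * pi * m * u)) ` I)"
      by (rule boundedI[of _ 1]) auto
    have ul: "uniform_limit I (\<lambda>n u. S n u * cos (2 * pi * m * u)) (\<lambda>u. d u * cos (2 * pi * m * u)) sequentially"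
    proof (rule uniform_lim_mult[OF unif uniform_limit_const _ cosb])
      show "bounded (d ` I)"
        by (rule compact_imp_bounded[OF compact_continuous_image[OF d_cont]]) (simp add: I_def)
    qed
    have ul': "uniform_limit {-(1/2)..1/2} (\<lambda>n u. S n u * cos (2 * pi * m * u)) (\<lambda>u. d u * cos (2 * pi * m * u)) sequentially"
      using ul by (simp only: I_def)
    have cont: "continuous_on {-(1/2)..1/2} (\<lambda>u. S n u * cos (2 * pi * m * u))" for n
      by (rule continuous_on_mult[OF S_cont[unfolded I_def]]) (intro continuous_intros)
    obtain J1 J2 where J: "\<And>n. ((\<lambda>u. S n u * cos (2 * pi * m * u)) has_integral J1 n) {-(1/2)..1/2}"
      "((\<lambda>u. d u * cos (2 * pi * m * u)) has_integral J2) {-(1/2)..1/2}" "J1 \<longlonglongrightarrow> J2"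
      by (rule uniform_limit_integral[OF ul' cont sequentially_bot]) (rule that)
    note J = J[folded I_def]
    have S_eq: "S n u * cos (2 * pi * m * u) = (G u + (\<Sum>k<n. P k u)) * cos (2 * pi * m * u)
          - (c + (\<Sum>k<n. R k u)) * cos (2 * pi * m * u)" for n u
    proof -
      have "S n u = (G u + (\<Sum>k<n. P k u)) - (c + (\<Sum>k<n. R k u))"
        by (simp add: S_def sum_subtractf)
      then show ?thesis by (simp only: left_diff_distrib)
    qed
    have J1: "J1 n = integral {-(real n + 1/2)..real n + 1/2} (\<lambda>v. G v * cos (2 * pi * m * v))
       - integral I (\<lambda>u. (c + (\<Sum>k<n. R k u)) * cos (2 * pi * m * u))" for n
    proof -
      have "J1 n = integral I (\<lambda>u. S n u * cos (2 * pi * m * u))"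
        by (rule integral_unique[OF J(1), symmetric])
      also have "\<dots> = integral I (\<lambda>u. (G u + (\<Sum>k<n. P k u)) * cos (2 * pi * m * u))
          - integral I (\<lambda>u. (c + (\<Sum>k<n. R k u)) * cos (2 * pi * m * u))"
        unfolding S_eq unfolding I_def P_def R_def
        by (intro Henstock_Kurzweil_Integration.integral_diff integrable_continuous_real continuous_intros)
      finally show ?thesis unfolding G_combine .
    qed
    have ev: "\<forall>\<^sub>F n in sequentially. integral {-(real n + 1/2)..real n + 1/2} (\<lambda>v. G v * cos (2 * pi * m * v))
       - c * exp (- pi * (real m)\<^sup>2 * (1 / x)) = J1 n"
      using eventually_ge_at_top[of m] by eventually_elim (simp only: J1 R_int)
    have "(\<lambda>n. integral {-(real n + 1/2)..real n + 1/2} (\<lambda>v. G v * cos (2 * pi * m * v))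
       - c * exp (- pi * (real m)\<^sup>2 * (1 / x))) \<longlonglongrightarrow>
       c * exp (- pi * (real m)\<^sup>2 * (1 / x)) - c * exp (- pi * (real m)\<^sup>2 * (1 / x))"
      by (intro tendsto_diff G_lim tendsto_const)
    then have "J1 \<longlonglongrightarrow> 0"
      unfolding diff_self by (rule Lim_transform_eventually[OF _ ev])
    then have J2: "J2 = 0" by (rule LIMSEQ_unique[OF J(3)])
    show ?thesis using integral_unique[OF J(2)] unfolding J2 .
  qed
  have P_even: "P k (- u) = P k u" for k u
    by (simp add: P_def G_def power2_eq_square algebra_simps)
  have d_even: "d (- u) = d u" for u
    unfolding d_def P_even by (simp add: G_even R_def)
  have "d 0 = 0"
    by (rule even_cosine_moments_zero[OF d_cont[unfolded I_def] d_even moments[unfolded I_def]]) simp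
  moreover have "P k 0 - R k 0 = 2 * exp (- pi * (real (Suc k))\<^sup>2 * x) - 2 * c * exp (- pi * (real (Suc k))\<^sup>2 * (1 / x))" for k
    by (simp add: P_def R_def G_def mult_ac power2_eq_square algebra_simps)
  moreover have "(\<lambda>k. 2 * exp (- pi * (real (Suc k))\<^sup>2 * x) - 2 * c * exp (- pi * (real (Suc k))\<^sup>2 * (1 / x)))
     sums (2 * (\<Sum>k. exp (- pi * (real (Suc k))\<^sup>2 * x)) - 2 * c * (\<Sum>k. exp (- pi * (real (Suc k))\<^sup>2 * (1 / x))))"
    using x by (intro sums_diff sums_mult summable_sums summable_jacobi_theta) auto
  ultimately show ?thesis
    by (simp add: d_def G_def sums_iff jacobi_theta_def c_def[symmetric] algebra_simps)
qed

text \<open>The unordered sum over all integers is the form that multiplies over coordinates; it is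
  assembled from the positive integers, the negative ones and 0.\<close>

lemma has_sum_jacobi_theta:
  assumes "x > 0"
  shows "((\<lambda>k::int. exp (- pi * (of_int k)\<^sup>2 * x)) has_sum jacobi_theta x) UNIV"
proof -
  define S where "S = (\<Sum>k. exp (- pi * (real (Suc k))\<^sup>2 * x))"
  have "((\<lambda>k. exp (- pi * (real (Suc k))\<^sup>2 * x)) has_sum S) UNIV"
    unfolding S_def by (intro sums_nonneg_imp_has_sum summable_sums summable_jacobi_theta assms) auto
  then have "((\<lambda>k. exp (- pi * (of_int (int (Suc k)))\<^sup>2 * x)) has_sum S) UNIV"
    "((\<lambda>k. exp (- pi * (of_int (- int (Suc k)))\<^sup>2 * x)) has_sum S) UNIV"
    by (simp_all only: of_int_minus power2_minus of_int_of_nat_eq)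
  moreover have "bij_betw (\<lambda>k. int (Suc k)) UNIV {1..}"
    by (rule bij_betwI[where g = "\<lambda>k. nat (k - 1)"]) auto
  moreover have "bij_betw (\<lambda>k. - int (Suc k)) UNIV {..-1}"
    by (rule bij_betwI[where g = "\<lambda>k. nat (- k - 1)"]) auto
  ultimately have "((\<lambda>k::int. exp (- pi * (of_int k)\<^sup>2 * x)) has_sum S) {1..}"
    "((\<lambda>k::int. exp (- pi * (of_int k)\<^sup>2 * x)) has_sum S) {..-1}"
    by (simp_all only: has_sum_reindex_bij_betw[of _ UNIV _ "\<lambda>k::int. exp (- pi * (of_int k)\<^sup>2 * x)"])
  then have "((\<lambda>k::int. exp (- pi * (of_int k)\<^sup>2 * x)) has_sum (S + S)) ({1..} \<union> {..-1})"
    by (intro has_sum_Un_disjoint) auto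
  then have "((\<lambda>k::int. exp (- pi * (of_int k)\<^sup>2 * x)) has_sum
      (exp (- pi * (of_int 0)\<^sup>2 * x) + (S + S))) (insert 0 ({1..} \<union> {..-1}))"
    by (intro has_sum_insert) auto
  moreover have "insert 0 ({1..} \<union> {..-1}) = (UNIV :: int set)" by auto
  ultimately show ?thesis by (simp add: jacobi_theta_def S_def)
qed

lemma jacobi_theta_ge_1:
  assumes "x > 0"
  shows "jacobi_theta x \<ge> 1"
  unfolding jacobi_theta_def using suminf_nonneg[OF summable_jacobi_theta[OF assms]] by simp

text \<open>On the half-line beyond \<open>x/2\<close> each term is at most its value at
  \<open>x/2\<close>, so convergence is uniform there.\<close>

lemma isCont_jacobi_theta:
  assumes "x > 0"
  shows "isCont jacobi_theta x"
proof -
  have "uniform_limit {x/2<..} (\<lambda>n y. \<Sum>k<n. exp (- pi * (real (Suc k))\<^sup>2 * y))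
      (\<lambda>y. \<Sum>k. exp (- pi * (real (Suc k))\<^sup>2 * y)) sequentially"
  proof (rule Weierstrass_m_test)
    fix k :: nat and y assume "y \<in> {x/2<..}"
    then have "pi * (real (Suc k))\<^sup>2 * (x/2) \<le> pi * (real (Suc k))\<^sup>2 * y"
      by (intro mult_left_mono) auto
    then show "norm (exp (- pi * (real (Suc k))\<^sup>2 * y)) \<le> exp (- pi * (real (Suc k))\<^sup>2 * (x/2))"
      by simp
  qed (rule summable_jacobi_theta, use assms in simp)
  then have "continuous_on {x/2<..} (\<lambda>y. \<Sum>k. exp (- pi * (real (Suc k))\<^sup>2 * y))"
    by (rule uniform_limit_theorem[rotated]) (auto intro!: always_eventually continuous_intros)
  then have "continuous_on {x/2<..} jacobi_theta"
    unfolding jacobi_theta_def[abs_def] by (intro continuous_intros)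
  then show ?thesis
    using assms by (simp add: continuous_on_eq_continuous_at)
qed

section \<open>Theta series of orthogonal lattices\<close>

definition quad_form :: "real^'n \<Rightarrow> int^'n \<Rightarrow> real" where
  "quad_form a k = (\<Sum>j\<in>UNIV. a $ j * (of_int (k $ j))\<^sup>2)"

text \<open>An enumeration of the nonzero integer vectors, which makes the sequence-based results of
  \<open>theta_pair\<close> applicable. The order is immaterial, since all series involved converge
  absolutely.\<close>

definition nonzero_vec :: "nat \<Rightarrow> int^'n" where
  "nonzero_vec = from_nat_into (UNIV - {0})"

text \<open>For \<open>a $ j = 1 / q_j^2\<close> these are the Laplace eigenvalues divided by
  \<open>4 * pi\<close>, the normalization in which the theta series obeys inversion without further
  constants.\<close>

definition spectrum :: "real^'n \<Rightarrow> nat \<Rightarrow> real" where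
  "spectrum a i = pi * quad_form a (nonzero_vec i)"

lemma bij_nonzero_vec: "bij_betw (nonzero_vec :: nat \<Rightarrow> int^'n) UNIV (UNIV - {0})"
  unfolding nonzero_vec_def
proof (rule bij_betw_from_nat_into)
  have "inj (\<lambda>m::nat. \<chi> i::'n. int m)"
    by (auto simp: inj_on_def vec_eq_iff)
  then have "infinite (UNIV :: (int^'n) set)"
    by (meson finite_subset infinite_UNIV_nat range_inj_infinite subset_UNIV)
  then show "infinite (UNIV - {0 :: int^'n})" by simp
qed auto

lemma nonzero_vec_nonzero: "nonzero_vec i \<noteq> 0"
  using bij_betwE[OF bij_nonzero_vec] by blast

lemma quad_form_ge:
  assumes a: "\<And>j. m \<le> a $ j" and m: "m > 0" and k: "k \<noteq> 0"
  shows "m \<le> quad_form a k"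
proof -
  obtain j where j: "k $ j \<noteq> 0" using k by (auto simp: vec_eq_iff)
  have pos: "a $ i > 0" for i using a[of i] m by simp
  have "1 \<le> \<bar>k $ j\<bar>" using j by linarith
  then have "1 \<le> (real_of_int (k $ j))\<^sup>2"
    by (metis abs_le_square_iff abs_one of_int_1 of_int_abs of_int_le_iff one_power2)
  then have "m * 1 \<le> a $ j * (of_int (k $ j))\<^sup>2"
    using a[of j] m by (intro mult_mono) auto
  also have "\<dots> \<le> quad_form a k"
    unfolding quad_form_def using pos[THEN less_imp_le] by (intro member_le_sum) auto
  finally show ?thesis by simp
qed

lemma spectrum_ge:
  assumes "\<And>j. m \<le> a $ j" "m > 0"
  shows "pi * m \<le> spectrum a i"
  unfolding spectrum_def using quad_form_ge[OF assms nonzero_vec_nonzero] by simp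

text \<open>The exponential of the quadratic form factors over the coordinates, so the sum over all
  integer vectors is a product of one-dimensional theta series; the summand 1 is the zero
  vector.\<close>

lemma
  fixes a :: "real^'n"
  assumes a: "\<And>j. a $ j > 0" and t: "t > 0"
  shows summable_spectrum: "summable (\<lambda>i. exp (- spectrum a i * t))"
    and exp_sum_spectrum: "1 + exp_sum (spectrum a) t = (\<Prod>j\<in>UNIV. jacobi_theta (a $ j * t))"
proof -
  define f where "f = (\<lambda>k :: int^'n. exp (- pi * quad_form a k * t))"
  define h where "h = (\<lambda>j (k::int). exp (- pi * (of_int k)\<^sup>2 * (a $ j * t)))"
  have pos: "a $ j * t > 0" for j using a t by simp
  have h: "(h j has_sum jacobi_theta (a $ j * t)) UNIV" for j
    unfolding h_def by (rule has_sum_jacobi_theta[OF pos])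
  have f_eq: "f k = (\<Prod>j\<in>UNIV. h j (k $ j))" for k
    by (simp add: f_def h_def quad_form_def exp_sum[symmetric] sum_distrib_left sum_distrib_right
          sum_negf[symmetric] mult_ac)
  have bij: "bij_betw (vec_nth :: int^'n \<Rightarrow> _) UNIV UNIV"
    by (rule bij_betwI[where g = vec_lambda]) auto
  have "infsum f UNIV = infsum (\<lambda>g. \<Prod>j\<in>UNIV. h j (g j)) (PiE UNIV (\<lambda>_. UNIV))"
    unfolding f_eq PiE_UNIV by (rule infsum_reindex_bij_betw[OF bij])
  also have "\<dots> = (\<Prod>j\<in>UNIV. infsum (h j) UNIV)"
  proof (rule infsum_prod_PiE_abs)
    have "(\<lambda>k. norm (h j k)) = h j" for j by (auto simp: h_def)
    then show "(\<lambda>k. norm (h j k)) summable_on UNIV" for j using has_sum_imp_summable[OF h] by simp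
  qed simp
  also have "\<dots> = (\<Prod>j\<in>UNIV. jacobi_theta (a $ j * t))"
    using infsumI[OF h] by simp
  finally have f_sum: "infsum f UNIV = (\<Prod>j\<in>UNIV. jacobi_theta (a $ j * t))" .
  \<comment> \<open>\<open>infsum\<close> of a function that is not summable is 0 by default. Every
    theta factor is at least 1, so the nonzero value just computed proves summability.\<close>
  have "(\<Prod>j\<in>UNIV. jacobi_theta (a $ j * t)) \<noteq> 0"
    using jacobi_theta_ge_1[OF pos] by (simp add: prod_zero_iff) (metis not_one_le_zero)
  then have f_summable: "f summable_on UNIV"
    using infsum_not_exists f_sum by metis
  have f_summable': "f summable_on (UNIV - {0})"
    by (rule summable_on_cofin_subset[OF f_summable]) simp
  have f_nat: "(\<lambda>i. f (nonzero_vec i)) = (\<lambda>i. exp (- spectrum a i * t))"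
    by (simp add: f_def spectrum_def)
  have "((\<lambda>i. f (nonzero_vec i)) has_sum infsum f (UNIV - {0})) UNIV"
    unfolding has_sum_reindex_bij_betw[OF bij_nonzero_vec] using f_summable' by simp
  then have sums: "(\<lambda>i. exp (- spectrum a i * t)) sums infsum f (UNIV - {0})"
    unfolding f_nat by (rule has_sum_imp_sums)
  then show "summable (\<lambda>i. exp (- spectrum a i * t))" by (rule sums_summable)
  have "infsum f (insert 0 (UNIV - {0})) = f 0 + infsum f (UNIV - {0})"
    by (rule infsum_insert[OF f_summable']) simp
  then show "1 + exp_sum (spectrum a) t = (\<Prod>j\<in>UNIV. jacobi_theta (a $ j * t))"
    using sums_unique[OF sums] f_sum by (simp add: exp_sum_def f_def quad_form_def insert_absorb)
qed

definition vec_inverse :: "real^'n \<Rightarrow> real^'n" where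
  "vec_inverse a = (\<chi> j. 1 / a $ j)"

text \<open>One-dimensional inversion in every coordinate leaves the factor
  \<open>(a $ j * t) powr - (1/2)\<close> each time; as the entries of \<open>a\<close> multiply to
  1, these combine to \<open>t powr - (n / 2)\<close>. The constant \<open>m\<close> comes from the
  smallest entry of \<open>a\<close> and its inverse.\<close>

lemma spectrum_theta_pair:
  fixes a :: "real^'n"
  assumes a: "\<And>j. a $ j > 0" and prod: "(\<Prod>j\<in>UNIV. a $ j) = 1"
  obtains m where "theta_pair (spectrum a) (spectrum (vec_inverse a)) m (real CARD('n) / 2)"
proof -
  define m where "m = Min (range (\<lambda>j. a $ j) \<union> range (\<lambda>j. vec_inverse a $ j))"
  have inv: "vec_inverse a $ j > 0" for j using a by (simp add: vec_inverse_def)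
  have m: "m > 0" unfolding m_def using a inv by (subst Min_gr_iff) auto
  have m_le: "m \<le> a $ j" "m \<le> vec_inverse a $ j" for j
    unfolding m_def by (auto intro!: Min_le)
  show thesis
  proof (rule that[of "pi * m"], rule theta_pair.intro)
    fix t :: real assume t: "t > 0"
    have "1 + exp_sum (spectrum a) t = (\<Prod>j\<in>UNIV. jacobi_theta (a $ j * t))"
      by (rule exp_sum_spectrum[OF a t])
    also have "\<dots> = (\<Prod>j\<in>UNIV. (a $ j * t) powr - (1/2) * jacobi_theta (vec_inverse a $ j * (1 / t)))"
    proof (rule prod.cong)
      fix j
      show "jacobi_theta (a $ j * t) = (a $ j * t) powr - (1/2) * jacobi_theta (vec_inverse a $ j * (1 / t))"
        using jacobi_theta_inversion[of "a $ j * t"] a[of j] t by (simp add: vec_inverse_def)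
    qed simp
    also have "\<dots> = (\<Prod>j\<in>UNIV. (a $ j * t)) powr - (1/2) * (1 + exp_sum (spectrum (vec_inverse a)) (1 / t))"
    proof -
      have "(\<Prod>j\<in>UNIV. (a $ j * t) powr - (1/2)) = (\<Prod>j\<in>UNIV. a $ j * t) powr - (1/2)"
        by (rule prod_powr_distrib[symmetric])
      then show ?thesis
        using t inv by (simp only: prod.distrib exp_sum_spectrum zero_less_divide_1_iff)
    qed
    also have "(\<Prod>j\<in>UNIV. (a $ j * t)) = t powr real CARD('n)"
      using t by (simp add: prod.distrib prod powr_realpow)
    also have "(t powr real CARD('n)) powr - (1/2) = t powr - (real CARD('n) / 2)"
      by (simp add: powr_powr)
    finally show "1 + exp_sum (spectrum a) t = t powr - (real CARD('n) / 2) * (1 + exp_sum (spectrum (vec_inverse a)) (1 / t))" .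
    show "summable (\<lambda>i. exp (- spectrum a i * t))"
      "summable (\<lambda>i. exp (- spectrum (vec_inverse a) i * t))"
      by (rule summable_spectrum[OF a t], rule summable_spectrum[OF inv t])
  next
    show "pi * m \<le> spectrum a i" "pi * m \<le> spectrum (vec_inverse a) i" for i
      by (rule spectrum_ge[OF m_le(1) m], rule spectrum_ge[OF m_le(2) m])
  qed (use m in simp_all)
qed

section \<open>The determinant and its maximum\<close>

text \<open>The value \<open>M 0\<close> of \<open>theta_pair\<close> as a real integral. At volume
  1 it is the only part of the logarithm of the determinant that depends on the torus.\<close>

definition zeta_energy :: "real^'n \<Rightarrow> real" where
  "zeta_energy a = (LINT t|lborel. indicator {0<..} t *
     (t powr - 1 * mellin_kernel (spectrum a) (spectrum (vec_inverse a)) (real CARD('n) / 2) t))"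

text \<open>The function \<open>Z\<close>, which is \<open>(4 * pi) powr - s\<close> times the
  continued Dirichlet series of \<open>spectrum a\<close>, is a spectral zeta function. By
  uniqueness near 0 the chosen one has the same derivative there.\<close>

lemma laplace_zeta_det_eq:
  fixes D :: "real^'n^'n"
  assumes D: "diagonal_invertible D" "\<Gamma> = (\<lambda>x. D *v x) ` integer_lattice" and det: "\<bar>det D\<bar> = 1"
  shows "laplace_zeta_det \<Gamma> =
     exp (2 / real CARD('n) + euler_mascheroni - ln (4 * pi) - zeta_energy (\<chi> j. 1 / (D $ j $ j)\<^sup>2))"
proof -
  define a :: "real^'n" where "a = (\<chi> j. 1 / (D $ j $ j)\<^sup>2)"
  define L where "L = complex_of_real (ln (4 * pi))"
  have a: "a $ j > 0" for j using diagonal_entry_nonzero[OF D(1)] by (simp add: a_def)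
  have "(\<Prod>j\<in>UNIV. a $ j) = 1 / \<bar>det D\<bar>\<^sup>2"
    by (simp add: a_def diagonal_det[OF D(1)] prod_dividef prod_power_distrib)
  then have prod_a: "(\<Prod>j\<in>UNIV. a $ j) = 1" using det by simp
  obtain m where "theta_pair (spectrum a) (spectrum (vec_inverse a)) m (real CARD('n) / 2)"
    using spectrum_theta_pair[OF a prod_a] .
  then interpret theta_pair "spectrum a" "spectrum (vec_inverse a)" m "real CARD('n) / 2" .
  have spec_pos: "spectrum a i > 0" for i using m_pos \<mu>_ge[of i] by simp
  have eig: "laplace_eigenvalue \<Gamma> (nonzero_vec i) = 4 * pi * spectrum a i" for i
    by (simp add: laplace_eigenvalue_eq[OF D] spectrum_def quad_form_def a_def power2_eq_square
          sum_distrib_left mult_ac)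
  define Z where "Z = (\<lambda>s. exp (- s * L) * continued_zeta s)"
  have term_eq: "complex_of_real (laplace_eigenvalue \<Gamma> (nonzero_vec i)) powr (- s) =
      exp (- s * L) * complex_of_real (spectrum a i) powr (- s)" for i s
  proof -
    have "ln (4 * pi * spectrum a i) = ln (4 * pi) + ln (spectrum a i)"
      using spec_pos[of i] by (subst ln_mult) auto
    moreover have "4 * pi * spectrum a i > 0" using spec_pos[of i] by simp
    ultimately show ?thesis
      using spec_pos[of i] unfolding eig L_def
      by (simp add: powr_def Ln_of_real exp_add[symmetric] algebra_simps del: of_real_mult)
  qed
  have Z: "is_spectral_zeta \<Gamma> Z"
    unfolding is_spectral_zeta_def
  proof (intro conjI allI impI)
    show "Z meromorphic_on UNIV"
      unfolding Z_def by (intro meromorphic_on_mult continued_zeta_meromorphic analytic_on_imp_meromorphic_on analytic_intros)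
    show "Z analytic_on {0}"
      unfolding Z_def by (intro analytic_intros continued_zeta_analytic_0)
  next
    fix s assume s: "Re s > real CARD('n) / 2"
    have "((\<lambda>i. complex_of_real (spectrum a i) powr (- s)) has_sum continued_zeta s) UNIV"
      by (rule norm_summable_imp_has_sum[OF dirichlet_series[OF s]])
    then have "((\<lambda>i. complex_of_real (laplace_eigenvalue \<Gamma> (nonzero_vec i)) powr (- s)) has_sum Z s) UNIV"
      unfolding term_eq Z_def by (rule has_sum_cmult_right)
    then have "((\<lambda>k. complex_of_real (laplace_eigenvalue \<Gamma> k) powr (- s)) has_sum Z s) (UNIV - {0})"
      using has_sum_reindex_bij_betw[OF bij_nonzero_vec, of "\<lambda>k. complex_of_real (laplace_eigenvalue \<Gamma> k) powr (- s)"]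
      by blast
    then show "Z s = spectral_zeta_series \<Gamma> s"
      by (simp add: spectral_zeta_series_def infsumI)
  qed
  have "is_spectral_zeta \<Gamma> (spectral_zeta \<Gamma>)"
    unfolding spectral_zeta_def by (rule someI[of _ Z]) (rule Z)
  then have deriv: "deriv (spectral_zeta \<Gamma>) 0 = deriv Z 0"
    by (rule is_spectral_zeta_unique(2)[OF _ Z])
  \<comment> \<open>Product rule: the derivative \<open>- L\<close> of the exponential factor meets
    \<open>continued_zeta 0 = -1\<close>, hence the positive sign of \<open>L\<close>.\<close>
  have "(Z has_field_derivative (L + (M 0 - 1 / of_real (real CARD('n) / 2) - euler_mascheroni))) (at 0)"
    unfolding Z_def by (auto intro!: derivative_eq_intros continued_zeta_deriv_0 simp: continued_zeta_0)
  then have "deriv Z 0 = L + (M 0 - 1 / of_real (real CARD('n) / 2) - euler_mascheroni)"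
    by (rule DERIV_imp_deriv)
  also have "M 0 = of_real (zeta_energy a)"
    unfolding M_0 zeta_energy_def ..
  also have "L + (of_real (zeta_energy a) - 1 / of_real (real CARD('n) / 2) - euler_mascheroni) =
     of_real (ln (4 * pi) + (zeta_energy a - 2 / real CARD('n) - euler_mascheroni))"
    by (simp add: L_def of_real_euler_mascheroni)
  finally have "laplace_zeta_det \<Gamma> = exp (- (ln (4 * pi) + (zeta_energy a - 2 / real CARD('n) - euler_mascheroni)))"
    unfolding laplace_zeta_det_def deriv by (simp only: of_real_minus[symmetric] exp_of_real Re_complex_of_real)
  then show ?thesis unfolding a_def[symmetric] by (simp add: algebra_simps)
qed

section \<open>Monotonicity, coercivity and continuity of the energy\<close>

lemma exp_sum_antimono:
  assumes "\<And>i. \<nu> i \<le> \<mu> i" "summable (\<lambda>i. exp (- \<nu> i * t))" "summable (\<lambda>i. exp (- \<mu> i * t))" "t \<ge> 0"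
  shows "exp_sum \<mu> t \<le> exp_sum \<nu> t"
  unfolding exp_sum_def using assms by (intro suminf_le) (auto intro: mult_right_mono)

lemma spectrum_mono:
  assumes "\<And>j. b $ j \<le> a $ j"
  shows "spectrum b i \<le> spectrum a i"
  unfolding spectrum_def quad_form_def using assms by (intro mult_left_mono sum_mono mult_right_mono) auto

text \<open>Keep only the lattice vector \<open>axis j 1\<close>. For
  \<open>1 < t \<le> 1 / a $ j\<close> its term is at least \<open>exp (- pi)\<close>, and
  integrating \<open>1 / t\<close> over this range gives the logarithm. If
  \<open>a $ j \<ge> 1\<close>, the bound is not positive while the energy is nonnegative.\<close>

lemma zeta_energy_lower_bound:
  fixes a :: "real^'n"
  assumes a: "\<And>j. a $ j > 0" and prod: "(\<Prod>j\<in>UNIV. a $ j) = 1"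
  shows "exp (- pi) * ln (1 / a $ j) \<le> zeta_energy a"
proof -
  obtain m where "theta_pair (spectrum a) (spectrum (vec_inverse a)) m (real CARD('n) / 2)"
    using spectrum_theta_pair[OF a prod] .
  then interpret theta_pair "spectrum a" "spectrum (vec_inverse a)" m "real CARD('n) / 2" .
  define K where "K = (\<lambda>t. indicator {0<..} t *
     (t powr - 1 * mellin_kernel (spectrum a) (spectrum (vec_inverse a)) (real CARD('n) / 2) t))"
  have K_int: "integrable lborel K" unfolding K_def by (rule kernel_integrable)
  have K_nonneg: "K t \<ge> 0" for t
    using kernel_nonneg[of t] by (auto simp: K_def split: split_indicator)
  have energy: "zeta_energy a = integral\<^sup>L lborel K" by (simp add: zeta_energy_def K_def)
  show ?thesis
  proof (cases "a $ j < 1")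
    case False
    then have "ln (1 / a $ j) \<le> 0" using a[of j] by simp
    then have "exp (- pi) * ln (1 / a $ j) \<le> 0" by (simp add: mult_le_0_iff)
    also have "0 \<le> zeta_energy a" unfolding energy by (intro integral_nonneg_AE) (simp add: K_nonneg)
    finally show ?thesis .
  next
    case True
    define b where "b = 1 / a $ j"
    have b: "b > 1" using True a[of j] by (simp add: b_def)
    have "has_bochner_integral lborel (\<lambda>t. 1 / t * indicator {1..b} t) (ln b - ln 1)"
      using b by (intro has_bochner_integral_FTC_Icc_real)
        (auto intro!: derivative_eq_intros continuous_intros)
    then have log_int: "has_bochner_integral lborel (\<lambda>t. exp (- pi) * (1 / t * indicator {1..b} t)) (exp (- pi) * (ln b - ln 1))"
      by (rule has_bochner_integral_mult_right)
    have "exp (- pi) * ln b = (LINT t|lborel. exp (- pi) * (1 / t * indicator {1..b} t))"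
      using has_bochner_integral_integral_eq[OF log_int] by simp
    also have "\<dots> \<le> integral\<^sup>L lborel K"
    proof (rule integral_mono_AE)
      show "integrable lborel (\<lambda>t. exp (- pi) * (1 / t * indicator {1..b} t))"
        using log_int unfolding has_bochner_integral_iff by (rule conjunct1)
      \<comment> \<open>At \<open>t = 1\<close> the kernel is still in its dual branch, so this null
        point is left out of the comparison.\<close>
      have "exp (- pi) * (1 / t * indicator {1..b} t) \<le> K t" if "t \<noteq> 1" for t
      proof (cases "t \<in> {1<..b}")
        case t: True
        have "(axis j 1 :: int^'n) \<in> range nonzero_vec"
          unfolding bij_betw_imp_surj_on[OF bij_nonzero_vec] by (simp add: axis_eq_0_iff)
        then obtain i where i: "nonzero_vec i = (axis j 1 :: int^'n)" by (metis imageE)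
        have "quad_form a (axis j 1) = a $ j"
        proof -
          have "quad_form a (axis j 1) = (\<Sum>i\<in>UNIV. if i = j then a $ j else 0)"
            unfolding quad_form_def by (intro sum.cong) (auto simp: axis_def)
          then show ?thesis by simp
        qed
        then have spec: "spectrum a i = pi * a $ j" by (simp add: spectrum_def i)
        have "a $ j * t \<le> 1" using t a[of j] by (simp add: b_def pos_le_divide_eq mult.commute)
        then have "exp (- pi) \<le> exp (- spectrum a i * t)"
          using mult_left_mono[of "a $ j * t" 1 pi] by (simp add: spec mult.assoc)
        also have "\<dots> \<le> exp_sum (spectrum a) t"
          unfolding exp_sum_def using t sum_le_suminf[OF summable_\<mu>[of t], of "{i}"] by simp
        finally have "exp (- pi) * (1 / t) \<le> exp_sum (spectrum a) t * (1 / t)"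
          using t by (intro mult_right_mono) auto
        moreover have "K t = exp_sum (spectrum a) t * (1 / t)"
          using t by (simp add: K_def mellin_kernel_def powr_minus_divide)
        ultimately show ?thesis using t by simp
      next
        case False
        then show ?thesis using that K_nonneg[of t] by (auto split: split_indicator)
      qed
      then show "AE t in lborel. exp (- pi) * (1 / t * indicator {1..b} t) \<le> K t"
        using AE_lborel_singleton[of "1::real"] by (auto elim!: eventually_mono)
    qed (rule K_int)
    finally show ?thesis by (simp add: energy b_def)
  qed
qed

text \<open>Dominated convergence. The exponential sums decrease in the parameter, so a vector below
  \<open>a\<close> and below its inverse for all \<open>a\<close> in the box yields a common
  integrable bound.\<close>

lemma zeta_energy_continuous:
  fixes m M :: real
  assumes "m > 0" "M > 0"
  shows "continuous_on {a :: real^'n. \<forall>j. m \<le> a $ j \<and> a $ j \<le> M} zeta_energy"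
proof (rule continuous_on_sequentiallyI)
  fix u :: "nat \<Rightarrow> real^'n" and x
  assume u: "\<forall>n. u n \<in> {a. \<forall>j. m \<le> a $ j \<and> a $ j \<le> M}"
    and x: "x \<in> {a. \<forall>j. m \<le> a $ j \<and> a $ j \<le> M}" and lim: "u \<longlonglongrightarrow> x"
  define p where "p = real CARD('n) / 2"
  \<comment> \<open>Entries of \<open>a\<close> are at least \<open>m\<close> and entries of its
    inverse at least \<open>1 / M\<close>, so \<open>c\<close> lies below both.\<close>
  define c :: "real^'n" where "c = (\<chi> j. min m (1 / M))"
  define k where "k = (\<lambda>a :: real^'n. mellin_kernel (spectrum a) (spectrum (vec_inverse a)) p)"
  define W where "W = (\<lambda>t. indicator {0<..} t * (t powr - 1 * mellin_kernel (spectrum c) (spectrum c) p t))"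
  have c: "c $ j > 0" for j using assms by (simp add: c_def)
  have in_box: "a $ j > 0" "vec_inverse a $ j > 0" "c $ j \<le> a $ j" "c $ j \<le> vec_inverse a $ j"
    if "a \<in> {a. \<forall>j. m \<le> a $ j \<and> a $ j \<le> M}" for a :: "real^'n" and j
  proof -
    have aj: "m \<le> a $ j" "a $ j \<le> M" using that by auto
    then show pos: "a $ j > 0" using assms by simp
    then show "vec_inverse a $ j > 0" by (simp add: vec_inverse_def)
    show "c $ j \<le> a $ j" using aj by (simp add: c_def)
    have "1 / M \<le> 1 / a $ j" using aj pos by (intro divide_left_mono) auto
    then show "c $ j \<le> vec_inverse a $ j" by (simp add: c_def vec_inverse_def)
  qed
  have c_ge: "pi * min m (1 / M) \<le> spectrum c i" for i
    using assms by (intro spectrum_ge) (auto simp: c_def)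
  have W: "integrable lborel W"
    unfolding W_def using assms c_ge summable_spectrum[OF c]
    by (intro mellin_kernel_integrable[of "pi * min m (1 / M)"]) auto
  have k_nonneg: "0 \<le> k a t" if "a \<in> {a. \<forall>j. m \<le> a $ j \<and> a $ j \<le> M}" "t > 0" for a t
    unfolding k_def by (intro mellin_kernel_nonneg summable_spectrum in_box[OF that(1)] that(2))
  have k_le: "k a t \<le> mellin_kernel (spectrum c) (spectrum c) p t"
    if a: "a \<in> {a. \<forall>j. m \<le> a $ j \<and> a $ j \<le> M}" and t: "t > 0" for a t
  proof -
    have "exp_sum (spectrum b) r \<le> exp_sum (spectrum c) r"
      if "\<And>j. c $ j \<le> b $ j" "\<And>j. b $ j > 0" "r > 0" for b r
      using that c by (intro exp_sum_antimono spectrum_mono summable_spectrum) auto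
    then show ?thesis
      unfolding k_def mellin_kernel_def using in_box[OF a] t by (auto intro!: mult_left_mono)
  qed
  \<comment> \<open>As a finite product of theta values, the kernel converges pointwise by
    continuity of \<open>jacobi_theta\<close>; no interchange of limit and series is left.\<close>
  have k_eq: "k a t = (if t > 1 then (\<Prod>j\<in>UNIV. jacobi_theta (a $ j * t)) - 1
      else t powr - p * ((\<Prod>j\<in>UNIV. jacobi_theta (1 / a $ j * (1 / t))) - 1))"
    if a: "a \<in> {a. \<forall>j. m \<le> a $ j \<and> a $ j \<le> M}" and t: "t > 0" for a t
  proof -
    have "exp_sum (spectrum a) t = (\<Prod>j\<in>UNIV. jacobi_theta (a $ j * t)) - 1"
      using exp_sum_spectrum[OF in_box(1)[OF a] t] by simp
    moreover have "exp_sum (spectrum (vec_inverse a)) (1 / t) = (\<Prod>j\<in>UNIV. jacobi_theta (1 / a $ j * (1 / t))) - 1"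
      using exp_sum_spectrum[OF in_box(2)[OF a], of "1 / t"] t by (simp add: vec_inverse_def)
    ultimately show ?thesis by (simp only: k_def mellin_kernel_def)
  qed
  have k_lim: "(\<lambda>n. k (u n) t) \<longlonglongrightarrow> k x t" if t: "t > 0" for t
  proof -
    have lim_j: "(\<lambda>n. u n $ j) \<longlonglongrightarrow> x $ j" for j by (intro tendsto_vec_nth lim)
    have x_pos: "x $ j > 0" for j by (rule in_box(1)[OF x])
    have theta_lim: "(\<lambda>n. jacobi_theta (f n)) \<longlonglongrightarrow> jacobi_theta y" if "f \<longlonglongrightarrow> y" "y > 0" for f y
      using isCont_tendsto_compose[OF isCont_jacobi_theta[OF that(2)] that(1)] .
    have "(\<lambda>n. if t > 1 then (\<Prod>j\<in>UNIV. jacobi_theta (u n $ j * t)) - 1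
      else t powr - p * ((\<Prod>j\<in>UNIV. jacobi_theta (1 / u n $ j * (1 / t))) - 1)) \<longlonglongrightarrow>
      (if t > 1 then (\<Prod>j\<in>UNIV. jacobi_theta (x $ j * t)) - 1
      else t powr - p * ((\<Prod>j\<in>UNIV. jacobi_theta (1 / x $ j * (1 / t))) - 1))"
    proof (cases "t > 1")
      case True
      have "(\<lambda>n. (\<Prod>j\<in>UNIV. jacobi_theta (u n $ j * t)) - 1) \<longlonglongrightarrow> (\<Prod>j\<in>UNIV. jacobi_theta (x $ j * t)) - 1"
        using x_pos t by (intro tendsto_intros theta_lim lim_j mult_pos_pos)
      then show ?thesis using True by simp
    next
      case False
      have "(\<lambda>n. t powr - p * ((\<Prod>j\<in>UNIV. jacobi_theta (1 / u n $ j * (1 / t))) - 1))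
         \<longlonglongrightarrow> t powr - p * ((\<Prod>j\<in>UNIV. jacobi_theta (1 / x $ j * (1 / t))) - 1)"
        using x_pos t by (intro tendsto_mult tendsto_diff tendsto_prod tendsto_const tendsto_divide theta_lim lim_j)
          (auto simp: less_imp_neq[OF x_pos, symmetric])
      then show ?thesis using False by simp
    qed
    then show ?thesis using u x t by (simp add: k_eq)
  qed
  have [measurable]: "k a \<in> borel_measurable borel" for a unfolding k_def by measurable
  have "(\<lambda>n. LINT t|lborel. indicator {0<..} t * (t powr - 1 * k (u n) t)) \<longlonglongrightarrow>
      (LINT t|lborel. indicator {0<..} t * (t powr - 1 * k x t))"
  proof (rule integral_dominated_convergence[OF _ _ W])
    show "AE t in lborel. (\<lambda>n. indicator {0<..} t * (t powr - 1 * k (u n) t)) \<longlonglongrightarrow> indicator {0<..} t * (t powr - 1 * k x t)"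
      by (rule AE_I2) (auto split: split_indicator intro!: tendsto_intros k_lim)
    fix n
    have un: "u n \<in> {a. \<forall>j. m \<le> a $ j \<and> a $ j \<le> M}" using u by blast
    have "norm (indicator {0<..} t * (t powr - 1 * k (u n) t)) \<le> W t" for t
    proof (cases "t > 0")
      case True
      have "\<bar>t powr - 1 * k (u n) t\<bar> = t powr - 1 * k (u n) t"
        using k_nonneg[OF un True] by simp
      also have "\<dots> \<le> t powr - 1 * mellin_kernel (spectrum c) (spectrum c) p t"
        by (intro mult_left_mono k_le un True) simp
      finally show ?thesis using True by (simp only: W_def) simp
    qed (simp add: W_def)
    then show "AE t in lborel. norm (indicator {0<..} t * (t powr - 1 * k (u n) t)) \<le> W t" by simp
  qed measurable
  then show "(\<lambda>n. zeta_energy (u n)) \<longlonglongrightarrow> zeta_energy x"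
    unfolding zeta_energy_def k_def p_def .
qed

text \<open>The sublevel set of the energy at the cubic torus \<open>e\<close> lies in the compact
  set \<open>K\<close>: the lower bound keeps the entries away from 0, and the product condition
  then bounds them above. Outside this sublevel set the energy exceeds its value at
  \<open>e\<close>, and \<open>e\<close> belongs to \<open>K\<close>.\<close>

lemma zeta_energy_attains_min:
  "\<exists>a\<^sub>0 :: real^'n. (\<forall>j. a\<^sub>0 $ j > 0) \<and> (\<Prod>j\<in>UNIV. a\<^sub>0 $ j) = 1 \<and>
     (\<forall>a :: real^'n. (\<forall>j. a $ j > 0) \<and> (\<Prod>j\<in>UNIV. a $ j) = 1 \<longrightarrow> zeta_energy a\<^sub>0 \<le> zeta_energy a)"
proof -
  define e :: "real^'n" where "e = (\<chi> j. 1)"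
  define E where "E = zeta_energy e"
  have E: "0 \<le> E" using zeta_energy_lower_bound[of e] unfolding E_def by (simp add: e_def)
  \<comment> \<open>The solution of \<open>exp (- pi) * ln (1 / m) = E\<close>; it is at most 1
    because \<open>E \<ge> 0\<close>.\<close>
  define m where "m = exp (- (exp pi * E))"
  have m: "0 < m" "m \<le> 1" using E by (simp_all add: m_def)
  \<comment> \<open>Each entry is the reciprocal of the product of the others, all at least
    \<open>m\<close>. The exponent is one larger than their number, which only weakens the bound as
    \<open>m \<le> 1\<close>.\<close>
  define M where "M = 1 / m ^ CARD('n)"
  have M: "M \<ge> 1" using m by (simp add: M_def power_le_one)
  define K where "K = {a :: real^'n. \<forall>j. m \<le> a $ j \<and> a $ j \<le> M} \<inter> {a. (\<Prod>j\<in>UNIV. a $ j) = 1}"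
  have "{a :: real^'n. \<forall>j. m \<le> a $ j \<and> a $ j \<le> M} = cbox (\<chi> j. m) (\<chi> j. M)"
    by (auto simp: mem_box_cart)
  then have "compact K"
    unfolding K_def by (auto intro!: compact_Int_closed compact_cbox closed_Collect_eq continuous_intros)
  moreover have e_K: "e \<in> K" using m M by (simp add: K_def e_def)
  moreover have "continuous_on K zeta_energy"
    using m M by (intro continuous_on_subset[OF zeta_energy_continuous[of m M]]) (auto simp: K_def)
  ultimately obtain a\<^sub>0 where a\<^sub>0: "a\<^sub>0 \<in> K" "\<And>a. a \<in> K \<Longrightarrow> zeta_energy a\<^sub>0 \<le> zeta_energy a"
    using continuous_attains_inf[of K zeta_energy] by blast
  show ?thesis
  proof (intro exI[of _ a\<^sub>0] conjI allI impI; (elim conjE)?)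
    show "a\<^sub>0 $ j > 0" for j using a\<^sub>0(1) m(1) by (auto simp: K_def intro: less_le_trans)
    show "(\<Prod>j\<in>UNIV. a\<^sub>0 $ j) = 1" using a\<^sub>0(1) by (simp add: K_def)
    show "zeta_energy a\<^sub>0 \<le> zeta_energy a"
      if "\<forall>j. a $ j > 0" and prod: "(\<Prod>j\<in>UNIV. a $ j) = 1" for a :: "real^'n"
    proof (cases "zeta_energy a \<le> E")
      case False
      then show ?thesis using a\<^sub>0(2)[OF e_K] by (simp add: E_def)
    next
      case True
      have pos: "a $ j > 0" for j using that(1) by blast
      have ge: "m \<le> a $ j" for j
      proof -
        have "exp (- pi) * ln (1 / a $ j) \<le> E"
          using zeta_energy_lower_bound[OF pos prod, of j] True by simp
        then have "exp pi * (exp (- pi) * ln (1 / a $ j)) \<le> exp pi * E"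
          by (intro mult_left_mono) auto
        then have "- ln (a $ j) \<le> exp pi * E"
          using pos[of j] by (simp add: ln_div mult.assoc[symmetric] exp_add[symmetric])
        then have "exp (- (exp pi * E)) \<le> exp (ln (a $ j))" by simp
        then show ?thesis using pos[of j] by (simp add: m_def)
      qed
      have "a $ j \<le> M" for j
      proof -
        have "m ^ CARD('n) \<le> m ^ card (UNIV - {j})"
          using m by (intro power_decreasing) (auto intro: card_mono)
        also have "\<dots> \<le> (\<Prod>i\<in>UNIV - {j}. a $ i)"
          using prod_mono[of "UNIV - {j}" "\<lambda>_. m" "\<lambda>i. a $ i"] ge m by simp
        finally have "a $ j * m ^ CARD('n) \<le> a $ j * (\<Prod>i\<in>UNIV - {j}. a $ i)"
          using pos[of j] by (intro mult_left_mono) auto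
        also have "\<dots> = 1" using prod.remove[of UNIV j "\<lambda>i. a $ i"] prod by simp
        finally show ?thesis using m by (simp add: M_def field_simps)
      qed
      then have "a \<in> K" using ge prod by (simp add: K_def)
      then show ?thesis by (rule a\<^sub>0(2))
    qed
  qed
qed

text \<open>At volume 1 the determinant is a decreasing function of \<open>zeta_energy\<close>, so
  the minimizing vector yields the maximizing torus once it is realized by a diagonal
  matrix.\<close>

theorem theorem2p2:
  shows "\<exists>\<Gamma>\<^sub>0 :: (real^'n) set.
           orthogonal_lattice \<Gamma>\<^sub>0 \<and> torus_volume \<Gamma>\<^sub>0 = 1 \<and>
           (\<forall>\<Gamma> :: (real^'n) set. orthogonal_lattice \<Gamma> \<and> torus_volume \<Gamma> = 1 \<longrightarrow>
              laplace_zeta_det \<Gamma> \<le> laplace_zeta_det \<Gamma>\<^sub>0)"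
proof -
  obtain a\<^sub>0 :: "real^'n" where a\<^sub>0: "\<forall>j. a\<^sub>0 $ j > 0" "(\<Prod>j\<in>UNIV. a\<^sub>0 $ j) = 1"
    "\<forall>a :: real^'n. (\<forall>j. a $ j > 0) \<and> (\<Prod>j\<in>UNIV. a $ j) = 1 \<longrightarrow> zeta_energy a\<^sub>0 \<le> zeta_energy a"
    using zeta_energy_attains_min[where 'n = 'n] by (elim exE conjE) (rule that)
  have pos: "a\<^sub>0 $ j > 0" for j using a\<^sub>0(1) by simp
  \<comment> \<open>The side lengths solve \<open>1 / q_j^2 = a\<^sub>0 $ j\<close>; the product
    condition on \<open>a\<^sub>0\<close> gives determinant 1.\<close>
  define D\<^sub>0 :: "real^'n^'n" where "D\<^sub>0 = (\<chi> i j. if i = j then 1 / sqrt (a\<^sub>0 $ i) else 0)"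
  define \<Gamma>\<^sub>0 where "\<Gamma>\<^sub>0 = (\<lambda>x. D\<^sub>0 *v x) ` integer_lattice"
  have "det D\<^sub>0 = (\<Prod>i\<in>UNIV. D\<^sub>0 $ i $ i)" by (rule det_diagonal) (simp add: D\<^sub>0_def)
  also have "\<dots> = 1 / sqrt (\<Prod>i\<in>UNIV. a\<^sub>0 $ i)"
  proof -
    have "(\<Prod>i\<in>UNIV. sqrt (a\<^sub>0 $ i)) = sqrt (\<Prod>i\<in>UNIV. a\<^sub>0 $ i)"
      by (induction rule: infinite_finite_induct[of _ UNIV]) (simp_all add: real_sqrt_mult)
    then show ?thesis by (simp add: D\<^sub>0_def prod_dividef)
  qed
  finally have det: "det D\<^sub>0 = 1" by (simp add: a\<^sub>0)
  then have vol\<^sub>0: "\<bar>det D\<^sub>0\<bar> = 1" by simp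
  have D\<^sub>0: "diagonal_invertible D\<^sub>0"
    using det by (auto simp: diagonal_invertible_def invertible_det_nz) (simp add: D\<^sub>0_def)
  have "1 / (D\<^sub>0 $ j $ j)\<^sup>2 = a\<^sub>0 $ j" for j
    using pos[of j] by (simp add: D\<^sub>0_def power_divide)
  then have a\<^sub>0_eq: "(\<chi> j. 1 / (D\<^sub>0 $ j $ j)\<^sup>2) = a\<^sub>0" by (simp add: vec_eq_iff)
  show ?thesis
  proof (rule exI[of _ \<Gamma>\<^sub>0], intro conjI allI impI)
    show "orthogonal_lattice \<Gamma>\<^sub>0" using D\<^sub>0 by (auto simp: orthogonal_lattice_def \<Gamma>\<^sub>0_def)
    show "torus_volume \<Gamma>\<^sub>0 = 1" using torus_volume_eq[OF D\<^sub>0 \<Gamma>\<^sub>0_def] det by simp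
    fix \<Gamma> :: "(real^'n) set" assume \<Gamma>: "orthogonal_lattice \<Gamma> \<and> torus_volume \<Gamma> = 1"
    then obtain D where D: "diagonal_invertible D" "\<Gamma> = (\<lambda>x. D *v x) ` integer_lattice"
      by (auto simp: orthogonal_lattice_def)
    have vol: "\<bar>det D\<bar> = 1" using torus_volume_eq[OF D] \<Gamma> by simp
    define a :: "real^'n" where "a = (\<chi> j. 1 / (D $ j $ j)\<^sup>2)"
    have "a $ j > 0" for j using diagonal_entry_nonzero[OF D(1)] by (simp add: a_def)
    moreover have "(\<Prod>j\<in>UNIV. a $ j) = 1 / \<bar>det D\<bar>\<^sup>2"
      by (simp add: a_def diagonal_det[OF D(1)] prod_dividef prod_power_distrib)
    ultimately have "zeta_energy a\<^sub>0 \<le> zeta_energy a" using vol a\<^sub>0(3) by auto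
    then show "laplace_zeta_det \<Gamma> \<le> laplace_zeta_det \<Gamma>\<^sub>0"
      unfolding laplace_zeta_det_eq[OF D vol] laplace_zeta_det_eq[OF D\<^sub>0 \<Gamma>\<^sub>0_def vol\<^sub>0] a\<^sub>0_eq a_def
      by simp
  qed
qed

end
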